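(* The Lie group of point symmetries of the Kuramoto–Sivashinsky equation $$h_t=\nu\nabla^2h-\kappa\nabla^4h+\lambda|\nabla h|^2$$ has a Lie algebra generated by the vector fields $\mathbf V=\xi^1\partial_x+\xi^2\partial_y+\xi^3\partial_t+\varphi\,\partial_h$, where $$\xi^1(x,y,t,h)=c_4y+c_2t+c_3,\qquad \xi^2(x,y,t,h)=-c_4x+c_5t+c_6,$$ $$\xi^3(x,y,t,h)=c_1,\qquad \varphi(x,y,t,h)=\Big(\frac{x}{2\lambda}\Big)c_2+\Big(\frac{y}{2\lambda}\Big)c_5+c_7,$$ and $c_i$, $i=1,\dots,7$, are arbitrary constants.
   Context: Here $h=h(x,y,t)$, the prefactors $\nu,\kappa,\lambda$ are constants, and $\nabla=(\partial_x,\partial_y)$, so $\nabla^2h=h_{xx}+h_{yy}$, $\nabla^4h=h_{xxxx}+2h_{xxyy}+h_{yyyy}$ and $|\nabla h|^2=h_x^2+h_y^2$. A vector field $\mathbf V=\xi^1\partial_x+\xi^2\partial_y+\xi^3\partial_t+\varphi\,\partial_h$, with coefficients functions of $(x,y,t,h)$, belongs to the Lie algebra of point symmetries of the equation $\Delta:=h_t-\nu\nabla^2h+\kappa\nabla^4h-\lambda|\nabla h|^2=0$ if its fourth prolongation $\mathbf V^{(4)}$ to the jet space of order 4 satisfies $\mathbf V^{(4)}(\Delta)=0$ whenever $\Delta=0$.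
   Formalization: The signs of the c_2 and c_5 terms of φ are corrected to −(x/2λ)c_2 − (y/2λ)c_5, since with plus signs the boosts are not symmetries; ν, κ, λ are assumed nonzero, since for ν=0 or κ=0 the algebra is larger and 1/(2λ) needs λ≠0. *)

theory Defs
  imports "HOL-Analysis.Analysis"
begin

text \<open>
  Infinitely often differentiable: differentiable everywhere, and every directional derivative
  is again smooth.
\<close>

coinductive smooth :: "('a::real_normed_vector \<Rightarrow> real) \<Rightarrow> bool" where
  "smooth f"
  if "\<forall>x. f differentiable (at x)"
    and "\<forall>v. smooth (\<lambda>x. frechet_derivative f (at x) v)"

datatype indep = X | Y | T

text \<open>
  A multi-index \<open>(i, j, k)\<close> stands for \<open>i\<close> derivatives in \<open>x\<close>, \<open>j\<close> in \<open>y\<close> and \<open>k\<close> in \<open>t\<close>.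
\<close>

type_synonym multi_index = "nat \<times> nat \<times> nat"

fun midx_order :: "multi_index \<Rightarrow> nat" where
  "midx_order (i, j, k) = i + j + k"

fun midx_unit :: "indep \<Rightarrow> multi_index" where
  "midx_unit X = (1, 0, 0)"
| "midx_unit Y = (0, 1, 0)"
| "midx_unit T = (0, 0, 1)"

text \<open>
  A jet assigns a value to every independent variable and to every derivative coordinate
  \<open>h\<^sub>J\<close>.  The jet space of order \<open>n\<close> is represented inside this space of jets of all orders: a
  function on it is a function that depends only on the coordinates \<open>Dep J\<close> with
  \<open>midx_order J \<le> n\<close>.
\<close>

datatype coord = Ind indep | Dep multi_index

type_synonym jet = "coord \<Rightarrow> real"

definition partial :: "coord \<Rightarrow> (jet \<Rightarrow> real) \<Rightarrow> jet \<Rightarrow> real" where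
  "partial c F p = deriv (\<lambda>s. F (p(c := s))) (p c)"

text \<open>
  The total derivative of a function \<open>F\<close> on the jet space of order \<open>n\<close>, which is a function on the
  jet space of order \<open>n + 1\<close>.
\<close>

definition total_deriv :: "nat \<Rightarrow> indep \<Rightarrow> (jet \<Rightarrow> real) \<Rightarrow> jet \<Rightarrow> real" where
  "total_deriv n i F p =
     partial (Ind i) F p
     + (\<Sum>J | midx_order J \<le> n. p (Dep (J + midx_unit i)) * partial (Dep J) F p)"

text \<open>
  \<open>\<xi>\<^sup>1\<partial>\<^sub>x + \<xi>\<^sup>2\<partial>\<^sub>y + \<xi>\<^sup>3\<partial>\<^sub>t + \<phi>\<partial>\<^sub>h\<close> with coefficients depending on \<open>(x, y, t, h)\<close>; \<open>\<xi>\<^sup>1\<close>, \<open>\<xi>\<^sup>2\<close>, \<open>\<xi>\<^sup>3\<close>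
  are \<open>xi V X\<close>, \<open>xi V Y\<close>, \<open>xi V T\<close>.
\<close>

record vector_field =
  xi :: "indep \<Rightarrow> real \<times> real \<times> real \<times> real \<Rightarrow> real"
  phi :: "real \<times> real \<times> real \<times> real \<Rightarrow> real"

definition smooth_vector_field :: "vector_field \<Rightarrow> bool" where
  "smooth_vector_field V \<longleftrightarrow> (\<forall>i. smooth (xi V i)) \<and> smooth (phi V)"

definition on_jet :: "(real \<times> real \<times> real \<times> real \<Rightarrow> real) \<Rightarrow> jet \<Rightarrow> real" where
  "on_jet f p = f (p (Ind X), p (Ind Y), p (Ind T), p (Dep (0, 0, 0)))"

text \<open>
  The recursion \<open>\<phi>\<^bsup>J,k\<^esup> = D\<^sub>k \<phi>\<^sup>J - (\<Sum>i. (D\<^sub>k \<xi>\<^sup>i) h\<^bsub>J,i\<^esub>)\<close> for the coefficients of a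
  prolonged vector field.  Since total derivatives commute on smooth functions, the order in which
  the entries of a multi-index are used up does not matter.
\<close>

definition prolong_step ::
    "vector_field \<Rightarrow> multi_index \<Rightarrow> indep \<Rightarrow> (jet \<Rightarrow> real) \<Rightarrow> jet \<Rightarrow> real" where
  "prolong_step V J k P p =
     total_deriv (midx_order J) k P p
     - (\<Sum>i\<in>{X, Y, T}. total_deriv 0 k (on_jet (xi V i)) p * p (Dep (J + midx_unit i)))"

fun prolong_coeff :: "vector_field \<Rightarrow> multi_index \<Rightarrow> jet \<Rightarrow> real" where
  "prolong_coeff V (0, 0, 0) = on_jet (phi V)"
| "prolong_coeff V (0, 0, Suc k) = prolong_step V (0, 0, k) T (prolong_coeff V (0, 0, k))"
| "prolong_coeff V (0, Suc j, k) = prolong_step V (0, j, k) Y (prolong_coeff V (0, j, k))"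
| "prolong_coeff V (Suc i, j, k) = prolong_step V (i, j, k) X (prolong_coeff V (i, j, k))"

definition prolongation :: "nat \<Rightarrow> vector_field \<Rightarrow> (jet \<Rightarrow> real) \<Rightarrow> jet \<Rightarrow> real" where
  "prolongation n V F p =
     (\<Sum>i\<in>{X, Y, T}. on_jet (xi V i) p * partial (Ind i) F p)
     + (\<Sum>J | midx_order J \<le> n. prolong_coeff V J p * partial (Dep J) F p)"

definition kuramoto_sivashinsky :: "real \<Rightarrow> real \<Rightarrow> real \<Rightarrow> jet \<Rightarrow> real" where
  "kuramoto_sivashinsky \<nu> \<kappa> lam p =
     p (Dep (0, 0, 1))
     - \<nu> * (p (Dep (2, 0, 0)) + p (Dep (0, 2, 0)))
     + \<kappa> * (p (Dep (4, 0, 0)) + 2 * p (Dep (2, 2, 0)) + p (Dep (0, 4, 0)))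
     - lam * ((p (Dep (1, 0, 0)))\<^sup>2 + (p (Dep (0, 1, 0)))\<^sup>2)"

text \<open>
  Sign of the Galilean boosts: for \<open>t\<partial>\<^sub>x + s x\<partial>\<^sub>h\<close> the fourth prolongation applied to the equation is
  \<open>- h\<^sub>x - 2 lam s h\<^sub>x\<close>, which vanishes for \<open>s = - 1 / (2 lam)\<close> and not for \<open>s = 1 / (2 lam)\<close>.
\<close>

definition ks_symmetry_algebra :: "real \<Rightarrow> real \<Rightarrow> real \<Rightarrow> vector_field set" where
  "ks_symmetry_algebra \<nu> \<kappa> lam =
     {V. smooth_vector_field V \<and>
         (\<forall>p. kuramoto_sivashinsky \<nu> \<kappa> lam p = 0 \<longrightarrow>
              prolongation 4 V (kuramoto_sivashinsky \<nu> \<kappa> lam) p = 0)}"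

end

theory Submission
  imports Defs
begin

text \<open>
  Write \<open>\<Delta>\<close> for the left-hand side of the equation and \<open>E\<close> for \<open>V\<^sup>(\<^sup>4\<^sup>)(\<Delta>)\<close>.  The classical proof
  expands \<open>E\<close> as a polynomial in the derivative coordinates and reads off coefficients.  The
  expansion is very long, and only a few of its coefficients matter.  They can be reached by
  differentiating \<open>E\<close> in one jet coordinate at a time, for which two facts suffice.

  First, with the characteristic \<open>Q = \<phi> - (\<Sum>i. \<xi>\<^sup>i h\<^sub>i)\<close> the prolongation coefficients are
  \<open>\<phi>\<^sup>J = D\<^sup>J Q + (\<Sum>i. \<xi>\<^sup>i h\<^bsub>J,i\<^esub>)\<close> (\<open>prolong_coeff_eq\<close>), and total derivatives satisfy
  \<open>[\<partial>/\<partial>h\<^sub>K, D\<^sub>i] = \<partial>/\<partial>h\<^bsub>K-i\<^esub>\<close> (\<open>partial_Dep_D\<close>).  As \<open>Q\<close> is affine in the first derivatives, with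
  coefficients \<open>- \<xi>\<^sup>i\<close>, pushing \<open>\<partial>/\<partial>h\<^sub>K\<close> through the iterated total derivatives leaves only
  total derivatives of \<open>\<xi>\<^sup>i\<close> and of \<open>\<partial>Q/\<partial>h\<close>, with binomial coefficients.

  Second, \<open>\<Delta> = 0\<close> is the graph of a function giving \<open>h\<^sub>t\<close>, so \<open>E = 0\<close> on it implies
  \<open>\<partial>E/\<partial>h\<^sub>K = \<partial>\<Delta>/\<partial>h\<^sub>K \<cdot> \<partial>E/\<partial>h\<^sub>t\<close> there (\<open>tangent_to_hypersurface\<close>).

  Now run through the coordinates by decreasing order.  Here \<open>\<xi>, \<eta>, \<tau>\<close> are the coefficients of
  \<open>\<partial>\<^sub>x, \<partial>\<^sub>y, \<partial>\<^sub>t\<close>.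
  \<^item> \<open>h\<^bsub>xxxt\<^esub>, h\<^bsub>yyyt\<^esub>\<close> give \<open>D\<^sub>x \<tau> = D\<^sub>y \<tau> = 0\<close>, so \<open>\<tau>\<close> depends on \<open>t\<close> only;
  \<^item> \<open>h\<^bsub>xxxx\<^esub>, h\<^bsub>yyyy\<^esub>\<close> give \<open>4 D\<^sub>x \<xi> = 4 D\<^sub>y \<eta> = \<tau>\<^sub>t\<close>, and \<open>h\<^bsub>xxxy\<^esub>\<close> gives \<open>D\<^sub>x \<eta> + D\<^sub>y \<xi> = 0\<close>;
    hence \<open>\<xi>, \<eta>\<close> do not involve \<open>h\<close> and are affine in \<open>(x, y)\<close>;
  \<^item> \<open>h\<^bsub>xxx\<^esub>, h\<^bsub>yyy\<^esub>\<close> give \<open>D\<^sub>x \<phi>\<^sub>h = D\<^sub>y \<phi>\<^sub>h = 0\<close>;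
  \<^item> \<open>h\<^bsub>xx\<^esub>\<close> gives \<open>\<nu> \<tau>\<^sub>t = 0\<close>: the second-order and the fourth-order term forbid dilations;
  \<^item> \<open>h\<^sub>x, h\<^sub>y\<close> give \<open>\<phi>\<^sub>h = 0\<close>, \<open>\<xi>\<^sub>t = - 2 \<lambda> \<phi>\<^sub>x\<close> and \<open>\<eta>\<^sub>t = - 2 \<lambda> \<phi>\<^sub>y\<close>, and then \<open>E = 0\<close> at jets
    without derivatives gives \<open>\<phi>\<^sub>t = 0\<close>.

  Comparing \<open>\<phi>\<^bsub>xy\<^esub>\<close> with \<open>\<phi>\<^bsub>yx\<^esub>\<close> shows that the rotation speed is constant in time, and then all four
  coefficients have constant gradient, so they are affine; the relations between the gradients
  leave exactly the seven constants.  Conversely, for such coefficients \<open>E\<close> vanishes identically.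
\<close>

section \<open>Smooth functions and symmetry of second derivatives\<close>

definition dird :: "'a::real_normed_vector \<Rightarrow> ('a \<Rightarrow> real) \<Rightarrow> 'a \<Rightarrow> real" where
  "dird v f = (\<lambda>z. frechet_derivative f (at z) v)"

lemma smooth_differentiable: "smooth f \<Longrightarrow> f differentiable (at z)"
  by (erule smooth.cases) auto

lemma smooth_dird: "smooth f \<Longrightarrow> smooth (dird v f)"
  unfolding dird_def by (erule smooth.cases) auto

lemma smooth_has_derivative: "smooth f \<Longrightarrow> (f has_derivative (\<lambda>v. dird v f z)) (at z)"
  using smooth_differentiable[of f z] unfolding dird_def
  by (simp add: frechet_derivative_works)

lemma smooth_continuous: "smooth f \<Longrightarrow> isCont f z"
  using smooth_differentiable differentiable_imp_continuous_within by blast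

lemma dird_linear: "smooth f \<Longrightarrow> linear (\<lambda>v. dird v f z)"
  using smooth_has_derivative has_derivative_linear by blast

lemma dird_eqI: "(f has_derivative f') (at z) \<Longrightarrow> dird v f z = f' v"
  using frechet_derivative_at by (metis dird_def)

lemma dird_const [simp]: "dird v (\<lambda>_. c) = (\<lambda>_. 0)"
  by (simp add: dird_def)

text \<open>
  Restricting to lines reduces the symmetry of second derivatives to the mean value theorem in one
  variable.
\<close>

lemma smooth_DERIV_line:
  assumes "smooth f"
  shows "((\<lambda>s. f (z + s *\<^sub>R v)) has_real_derivative dird v f (z + s *\<^sub>R v)) (at s)"
proof -
  have "((\<lambda>s. f (z + s *\<^sub>R v)) has_derivative (\<lambda>h. dird (h *\<^sub>R v) f (z + s *\<^sub>R v))) (at s)"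
    by (rule has_derivative_compose[OF _ smooth_has_derivative[OF assms]])
       (auto intro!: derivative_eq_intros)
  moreover have "dird (h *\<^sub>R v) f y = dird v f y * h" for h y
    using linear_scale[OF dird_linear[OF assms]] by simp
  ultimately show ?thesis by (simp add: has_field_derivative_def)
qed

text \<open>
  The second difference of \<open>f\<close> over a small parallelogram is symmetric in its two sides, but the
  mean value theorem, applied first along \<open>v\<close> and then along \<open>w\<close>, evaluates it by one particular
  mixed derivative.  The two orders of application are compared in \<open>dird_commute\<close>.
\<close>

lemma second_difference_mvt:
  assumes "smooth f" and "h > 0"
  obtains s t where "0 < s" "s < h" "0 < t" "t < h"
    "f (z + h *\<^sub>R v + h *\<^sub>R w) - f (z + h *\<^sub>R v) - f (z + h *\<^sub>R w) + f z
       = h\<^sup>2 * dird w (dird v f) (z + s *\<^sub>R v + t *\<^sub>R w)"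
proof -
  define g where "g s = f ((z + h *\<^sub>R w) + s *\<^sub>R v) - f (z + s *\<^sub>R v)" for s
  define g' where "g' s = dird v f ((z + h *\<^sub>R w) + s *\<^sub>R v) - dird v f (z + s *\<^sub>R v)" for s
  have "DERIV g s :> g' s" for s
    unfolding g_def g'_def by (intro DERIV_diff smooth_DERIV_line assms)
  then obtain s where s: "0 < s" "s < h" "g h - g 0 = h * g' s"
    using MVT2[of 0 h g g'] \<open>h > 0\<close> by auto
  define k where "k t = dird v f ((z + s *\<^sub>R v) + t *\<^sub>R w)" for t
  have "DERIV k t :> dird w (dird v f) ((z + s *\<^sub>R v) + t *\<^sub>R w)" for t
    unfolding k_def by (intro smooth_DERIV_line smooth_dird assms)
  then obtain t where t: "0 < t" "t < h"
      "k h - k 0 = h * dird w (dird v f) ((z + s *\<^sub>R v) + t *\<^sub>R w)"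
    using MVT2[of 0 h k "\<lambda>t. dird w (dird v f) ((z + s *\<^sub>R v) + t *\<^sub>R w)"] \<open>h > 0\<close> by auto
  have "g' s = k h - k 0" by (simp add: g'_def k_def algebra_simps)
  then show thesis
    using s t by (intro that[of s t]) (simp_all add: g_def power2_eq_square algebra_simps)
qed

text \<open>
  If the two mixed derivatives differed at \<open>z\<close>, then by continuity their values near \<open>z\<close> would be
  separated; the second difference over a small enough parallelogram is a value of both.
\<close>

lemma dird_commute:
  assumes "smooth f"
  shows "dird v (dird w f) = dird w (dird v f)"
proof
  fix z
  let ?a = "dird w (dird v f)" and ?b = "dird v (dird w f)"
  show "?b z = ?a z"
  proof (rule ccontr)
    assume neq: "?b z \<noteq> ?a z"
    define e where "e = \<bar>?b z - ?a z\<bar> / 2"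
    have "e > 0" using neq by (simp add: e_def)
    have "isCont ?a z" "isCont ?b z"
      by (intro smooth_continuous smooth_dird assms)+
    then obtain d1 d2 where d: "d1 > 0" "d2 > 0"
      "\<And>y. dist y z < d1 \<Longrightarrow> dist (?a y) (?a z) < e" "\<And>y. dist y z < d2 \<Longrightarrow> dist (?b y) (?b z) < e"
      using \<open>e > 0\<close> unfolding continuous_at_eps_delta by metis
    \<comment> \<open>small enough for the parallelogram with sides \<open>h v\<close>, \<open>h w\<close> to stay in both neighbourhoods\<close>
    define h where "h = min d1 d2 / (norm v + norm w + 1)"
    have "h > 0" using d by (simp add: h_def add_nonneg_pos)
    have near: "dist (z + s *\<^sub>R v + t *\<^sub>R w) z < min d1 d2" if "0 < s" "s < h" "0 < t" "t < h" for s t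
    proof -
      have "dist (z + s *\<^sub>R v + t *\<^sub>R w) z \<le> s * norm v + t * norm w"
        using that norm_triangle_ineq[of "s *\<^sub>R v" "t *\<^sub>R w"] by (simp add: dist_norm add.assoc)
      also have "\<dots> \<le> h * norm v + h * norm w"
        using that by (intro add_mono mult_right_mono) auto
      also have "\<dots> < h * (norm v + norm w + 1)"
        using \<open>h > 0\<close> by (simp add: algebra_simps)
      also have "\<dots> = min d1 d2"
        using add_nonneg_pos[of "norm v + norm w" 1] by (simp add: h_def)
      finally show ?thesis .
    qed
    obtain s t where st: "0 < s" "s < h" "0 < t" "t < h"
      "f (z + h *\<^sub>R v + h *\<^sub>R w) - f (z + h *\<^sub>R v) - f (z + h *\<^sub>R w) + f z
         = h\<^sup>2 * ?a (z + s *\<^sub>R v + t *\<^sub>R w)"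
      using second_difference_mvt[OF assms \<open>h > 0\<close>] by metis
    obtain s' t' where st': "0 < s'" "s' < h" "0 < t'" "t' < h"
      "f (z + h *\<^sub>R w + h *\<^sub>R v) - f (z + h *\<^sub>R w) - f (z + h *\<^sub>R v) + f z
         = h\<^sup>2 * ?b (z + s' *\<^sub>R w + t' *\<^sub>R v)"
      using second_difference_mvt[OF assms \<open>h > 0\<close>] by metis
    have "h\<^sup>2 * ?a (z + s *\<^sub>R v + t *\<^sub>R w) = h\<^sup>2 * ?b (z + t' *\<^sub>R v + s' *\<^sub>R w)"
      using st(5) st'(5) by (simp add: algebra_simps)
    then have "?a (z + s *\<^sub>R v + t *\<^sub>R w) = ?b (z + t' *\<^sub>R v + s' *\<^sub>R w)"
      using \<open>h > 0\<close> by simp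
    moreover have "dist (?a (z + s *\<^sub>R v + t *\<^sub>R w)) (?a z) < e"
      using near[OF st(1-4)] by (intro d) auto
    moreover have "dist (?b (z + t' *\<^sub>R v + s' *\<^sub>R w)) (?b z) < e"
      using near[OF st'(3,4,1,2)] by (intro d) auto
    ultimately show False
      unfolding e_def dist_real_def by argo
  qed
qed

lemma smooth_const: "smooth (\<lambda>_. c)"
  by (rule smooth.coinduct[of "\<lambda>f. \<exists>c. f = (\<lambda>_. c)"]) auto

lemma smooth_bounded_linear_plus_const:
  assumes "bounded_linear f"
  shows "smooth (\<lambda>z. f z + c)"
proof (rule smooth.intros)
  have d: "((\<lambda>z. f z + c) has_derivative f) (at z)" for z
    by (rule derivative_eq_intros bounded_linear_imp_has_derivative assms | simp)+
  then show "\<forall>z. (\<lambda>z. f z + c) differentiable at z"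
    unfolding differentiable_def by blast
  have "frechet_derivative (\<lambda>z. f z + c) (at z) = f" for z
    using frechet_derivative_at[OF d] by simp
  then show "\<forall>v. smooth (\<lambda>z. frechet_derivative (\<lambda>z. f z + c) (at z) v)"
    by (simp add: smooth_const)
qed

section \<open>Functions on the jet space\<close>

text \<open>
  The direction in the base \<open>(x, y, t, h)\<close> in which a jet coordinate moves: the higher derivative
  coordinates do not move the base at all.  With this convention \<open>partial c (on_jet f)\<close> has the
  same form for every coordinate \<open>c\<close>.
\<close>

fun coord_axis :: "coord \<Rightarrow> real \<times> real \<times> real \<times> real" where
  "coord_axis (Ind X) = (1, 0, 0, 0)"
| "coord_axis (Ind Y) = (0, 1, 0, 0)"
| "coord_axis (Ind T) = (0, 0, 1, 0)"
| "coord_axis (Dep J) = (if J = (0, 0, 0) then (0, 0, 0, 1) else 0)"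

definition pd :: "coord \<Rightarrow> (real \<times> real \<times> real \<times> real \<Rightarrow> real) \<Rightarrow> real \<times> real \<times> real \<times> real \<Rightarrow> real"
  where "pd c f = dird (coord_axis c) f"

lemma smooth_pd: "smooth f \<Longrightarrow> smooth (pd c f)"
  unfolding pd_def by (rule smooth_dird)

lemma pd_commute: "smooth f \<Longrightarrow> pd c (pd d f) = pd d (pd c f)"
  unfolding pd_def by (rule dird_commute)

lemma pd_const: "pd c (\<lambda>_. a) = (\<lambda>_. 0)"
  by (simp add: pd_def)

lemma pd_derivative_coord:
  assumes "smooth f" "J \<noteq> (0, 0, 0)"
  shows "pd (Dep J) f = (\<lambda>_. 0)"
  using linear_0[OF dird_linear[OF assms(1)]] assms(2) by (auto simp: pd_def)

text \<open>
  The ring generated by smooth functions of the base and the derivative coordinates.  It contains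
  every function met in a prolongation and is closed under partial and total derivatives, and
  induction over its construction replaces calculus on the infinite-dimensional space of jets.
\<close>

inductive jet_fun :: "(jet \<Rightarrow> real) \<Rightarrow> bool" where
  jet_fun_on_jet: "smooth f \<Longrightarrow> jet_fun (on_jet f)"
| jet_fun_coord: "jet_fun (\<lambda>p. p (Dep J))"
| jet_fun_add: "jet_fun F \<Longrightarrow> jet_fun G \<Longrightarrow> jet_fun (\<lambda>p. F p + G p)"
| jet_fun_mult: "jet_fun F \<Longrightarrow> jet_fun G \<Longrightarrow> jet_fun (\<lambda>p. F p * G p)"

lemma jet_fun_const: "jet_fun (\<lambda>_. c)"
  using jet_fun_on_jet[OF smooth_const[of c]] unfolding on_jet_def .

lemma jet_fun_minus: "jet_fun F \<Longrightarrow> jet_fun (\<lambda>p. - F p)"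
  using jet_fun_mult[OF jet_fun_const[of "-1"]] by simp

lemma jet_fun_diff: "jet_fun F \<Longrightarrow> jet_fun G \<Longrightarrow> jet_fun (\<lambda>p. F p - G p)"
  using jet_fun_add[OF _ jet_fun_minus] by simp

lemma jet_fun_sum: "(\<And>i. i \<in> A \<Longrightarrow> jet_fun (F i)) \<Longrightarrow> jet_fun (\<lambda>p. \<Sum>i\<in>A. F i p)"
  by (induction A rule: infinite_finite_induct) (auto intro: jet_fun_const jet_fun_add)

lemma jet_fun_power: "jet_fun F \<Longrightarrow> jet_fun (\<lambda>p. F p ^ n)"
  by (induction n) (auto intro: jet_fun_const jet_fun_mult)

lemmas jet_fun_intros =
  jet_fun_on_jet jet_fun_coord jet_fun_add jet_fun_mult jet_fun_const jet_fun_minus jet_fun_diff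
  jet_fun_sum jet_fun_power

text \<open>
  The curve \<open>\<gamma>\<close> need only be differentiable coordinate by coordinate, since \<open>on_jet f\<close> depends on
  four coordinates.
\<close>

lemma on_jet_DERIV_along:
  assumes "smooth f" and w: "\<And>c. ((\<lambda>s. \<gamma> s c) has_real_derivative w c) (at s0)"
  shows "((\<lambda>s. on_jet f (\<gamma> s)) has_real_derivative
           on_jet (dird (w (Ind X), w (Ind Y), w (Ind T), w (Dep (0, 0, 0))) f) (\<gamma> s0)) (at s0)"
proof -
  let ?base = "\<lambda>p::jet. (p (Ind X), p (Ind Y), p (Ind T), p (Dep (0, 0, 0)))"
  have "((\<lambda>s. \<gamma> s c) has_derivative (\<lambda>h. h * w c)) (at s0)" for c
    using w[of c] by (simp add: has_field_derivative_def mult_commute_abs)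
  then have "((\<lambda>s. ?base (\<gamma> s)) has_derivative (\<lambda>h. h *\<^sub>R ?base w)) (at s0)"
    by (auto intro!: has_derivative_Pair)
  from has_derivative_compose[OF this smooth_has_derivative[OF assms(1)]]
  have "((\<lambda>s. on_jet f (\<gamma> s)) has_derivative (\<lambda>h. dird (h *\<^sub>R ?base w) f (?base (\<gamma> s0)))) (at s0)"
    by (simp add: on_jet_def)
  moreover have "dird (h *\<^sub>R v) f y = dird v f y * h" for h v y
    using linear_scale[OF dird_linear[OF assms(1)]] by simp
  ultimately show ?thesis
    by (simp add: has_field_derivative_def on_jet_def del: scaleR_Pair)
qed

lemma jet_coord_line_DERIV:
  "((\<lambda>s. (p(c := s)) d) has_real_derivative (if d = c then 1 else 0)) (at s)"
  by (cases "d = c") auto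

lemma on_jet_DERIV_coord:
  assumes "smooth f"
  shows "((\<lambda>s. on_jet f (p(c := s))) has_real_derivative on_jet (pd c f) (p(c := s))) (at s)"
proof -
  have "coord_axis c = (if Ind X = c then 1 else 0, if Ind Y = c then 1 else 0, if Ind T = c then 1 else 0,
                  if Dep (0, 0, 0) = c then 1 else 0)"
    by (cases c rule: coord_axis.cases) (auto simp: zero_prod_def)
  with on_jet_DERIV_along[where \<gamma> = "\<lambda>s. p(c := s)", OF assms jet_coord_line_DERIV] show ?thesis
    by (simp add: pd_def)
qed

lemma jet_fun_differentiable_coord:
  "jet_fun F \<Longrightarrow> \<exists>D. ((\<lambda>s. F (p(c := s))) has_real_derivative D) (at s)"
proof (induction rule: jet_fun.induct)
  case (jet_fun_on_jet f) then show ?case using on_jet_DERIV_coord by blast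
next
  case (jet_fun_coord J) then show ?case using jet_coord_line_DERIV[of p c "Dep J"] by blast
next
  case (jet_fun_add F G) then show ?case using DERIV_add by blast
next
  case (jet_fun_mult F G) then show ?case using DERIV_mult by blast
qed

lemma jet_fun_DERIV_partial:
  assumes "jet_fun F"
  shows "((\<lambda>s. F (p(c := s))) has_real_derivative partial c F p) (at (p c))"
  using jet_fun_differentiable_coord[OF assms, of p c "p c"] DERIV_imp_deriv
  unfolding partial_def by blast

lemma partial_eqI:
  "(\<And>p. ((\<lambda>s. F (p(c := s))) has_real_derivative G p) (at (p c))) \<Longrightarrow> partial c F = G"
  unfolding partial_def by (auto simp: DERIV_imp_deriv)

lemma partial_on_jet: "smooth f \<Longrightarrow> partial c (on_jet f) = on_jet (pd c f)"
  using on_jet_DERIV_coord[of f _ c] by (intro partial_eqI) (metis fun_upd_triv)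

lemma partial_coord: "partial c (\<lambda>p. p (Dep J)) = (\<lambda>_. if Dep J = c then 1 else 0)"
  by (rule partial_eqI) (rule jet_coord_line_DERIV)

lemma partial_const: "partial c (\<lambda>_. a) = (\<lambda>_. 0)"
  by (rule partial_eqI) simp

lemma partial_add:
  assumes "jet_fun F" "jet_fun G"
  shows "partial c (\<lambda>p. F p + G p) = (\<lambda>p. partial c F p + partial c G p)"
  by (intro partial_eqI DERIV_add jet_fun_DERIV_partial assms)

lemma partial_diff:
  assumes "jet_fun F" "jet_fun G"
  shows "partial c (\<lambda>p. F p - G p) = (\<lambda>p. partial c F p - partial c G p)"
  by (intro partial_eqI DERIV_diff jet_fun_DERIV_partial assms)

lemma partial_minus:
  assumes "jet_fun F"
  shows "partial c (\<lambda>p. - F p) = (\<lambda>p. - partial c F p)"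
  by (intro partial_eqI DERIV_minus jet_fun_DERIV_partial assms)

lemma partial_mult:
  assumes "jet_fun F" "jet_fun G"
  shows "partial c (\<lambda>p. F p * G p) = (\<lambda>p. partial c F p * G p + F p * partial c G p)"
proof (rule partial_eqI)
  fix p
  show "((\<lambda>s. F (p(c := s)) * G (p(c := s))) has_real_derivative
          partial c F p * G p + F p * partial c G p) (at (p c))"
    using DERIV_mult[OF jet_fun_DERIV_partial[OF assms(1), of p c] jet_fun_DERIV_partial[OF assms(2), of p c]]
    by (simp add: algebra_simps)
qed

lemma partial_sum:
  "(\<And>i. i \<in> A \<Longrightarrow> jet_fun (F i)) \<Longrightarrow>
   partial c (\<lambda>p. \<Sum>i\<in>A. F i p) = (\<lambda>p. \<Sum>i\<in>A. partial c (F i) p)"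
  by (induction A rule: infinite_finite_induct)
     (simp_all add: partial_const partial_add jet_fun_sum)

lemmas partial_simps =
  partial_on_jet partial_coord partial_const partial_add partial_diff partial_minus partial_mult

lemma jet_fun_partial: "jet_fun F \<Longrightarrow> jet_fun (partial c F)"
  by (induction rule: jet_fun.induct)
     (simp_all add: partial_simps jet_fun_intros smooth_pd)

text \<open>
  The chain rule along curves moving two coordinates is all that is needed to move a jet within a
  hypersurface that is a graph over one of them.
\<close>

lemma jet_fun_chain_two:
  assumes "jet_fun F" and "c \<noteq> d" and g: "(g has_real_derivative g') (at (p c))" and "g (p c) = p d"
  shows "((\<lambda>s. F (p(c := s, d := g s))) has_real_derivative
           partial c F p + g' * partial d F p) (at (p c))"
  using assms(1)
proof (induction rule: jet_fun.induct)
  case (jet_fun_on_jet f)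
  define w where "w e = (if e = d then g' else if e = c then 1 else 0)" for e
  have p: "p(d := g (p c)) = p" using assms(4) by auto
  have "((\<lambda>s. (p(c := s, d := g s)) e) has_real_derivative w e) (at (p c))" for e
    using g \<open>c \<noteq> d\<close> by (auto simp: w_def)
  from on_jet_DERIV_along[where \<gamma> = "\<lambda>s. p(c := s, d := g s)", OF jet_fun_on_jet this]
  have "((\<lambda>s. on_jet f (p(c := s, d := g s))) has_real_derivative
          on_jet (dird (w (Ind X), w (Ind Y), w (Ind T), w (Dep (0, 0, 0))) f) p) (at (p c))"
    by (simp add: p)
  moreover have "(w (Ind X), w (Ind Y), w (Ind T), w (Dep (0, 0, 0))) = coord_axis c + g' *\<^sub>R coord_axis d"
    using \<open>c \<noteq> d\<close>
    by (cases c rule: coord_axis.cases; cases d rule: coord_axis.cases) (auto simp: w_def zero_prod_def)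
  moreover have "dird (coord_axis c + g' *\<^sub>R coord_axis d) f z = pd c f z + g' * pd d f z" for z
    using linear_add[OF dird_linear[OF jet_fun_on_jet]] linear_scale[OF dird_linear[OF jet_fun_on_jet]]
    by (simp add: pd_def)
  ultimately show ?case
    by (simp only: partial_on_jet[OF jet_fun_on_jet]) (simp only: on_jet_def)
next
  case (jet_fun_coord J)
  then show ?case using g \<open>c \<noteq> d\<close> by (auto simp: partial_coord)
next
  case (jet_fun_add F G)
  from DERIV_add[OF jet_fun_add.IH] show ?case
    by (simp add: partial_add jet_fun_add algebra_simps)
next
  case (jet_fun_mult F G)
  have p: "p(d := g (p c)) = p" using assms(4) by auto
  from DERIV_mult[OF jet_fun_mult.IH] show ?case
    by (simp add: partial_mult jet_fun_mult.hyps p del: fun_upd_apply) (simp add: algebra_simps)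
qed

text \<open>
  The hypothesis \<open>solved\<close> says that \<open>G\<close> is affine in \<open>d\<close> with slope \<open>1\<close>, so \<open>G = 0\<close> is a graph over
  the other coordinates.  Moving \<open>c\<close> and correcting \<open>d\<close> so as to stay on the graph keeps \<open>F\<close> equal
  to zero, and the conclusion is the vanishing of its derivative along that curve.
\<close>

lemma tangent_to_hypersurface:
  assumes F: "jet_fun F" and G: "jet_fun G"
    and solved: "\<And>p s. G (p(d := s)) = G p + (s - p d)"
    and vanish: "\<And>p. G p = 0 \<Longrightarrow> F p = 0" and "G p = 0" "c \<noteq> d"
  shows "partial c F p = partial c G p * partial d F p"
proof -
  define g where "g s = p d - G (p(c := s))" for s
  have "(g has_real_derivative - partial c G p) (at (p c))"
    unfolding g_def using jet_fun_DERIV_partial[OF G, of p c] by (auto intro!: derivative_eq_intros)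
  moreover have "g (p c) = p d" by (simp add: g_def \<open>G p = 0\<close>)
  ultimately have "((\<lambda>s. F (p(c := s, d := g s))) has_real_derivative
      partial c F p + (- partial c G p) * partial d F p) (at (p c))"
    using jet_fun_chain_two[OF F \<open>c \<noteq> d\<close>] by blast
  moreover have "F (p(c := s, d := g s)) = 0" for s
    using solved[of "p(c := s)" "g s"] \<open>c \<noteq> d\<close> by (intro vanish) (simp add: g_def)
  ultimately show ?thesis
    using DERIV_unique[of "\<lambda>_. 0", OF _ DERIV_const] by fastforce
qed

section \<open>Total derivatives\<close>

text \<open>
  A function lives on the jet space of order \<open>n\<close> if no coordinate of higher order has an influence
  on it.
\<close>

definition jet_order_le :: "nat \<Rightarrow> (jet \<Rightarrow> real) \<Rightarrow> bool" where
  "jet_order_le n F \<longleftrightarrow> (\<forall>J. n < midx_order J \<longrightarrow> partial (Dep J) F = (\<lambda>_. 0))"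

lemma midx_order_add [simp]: "midx_order (J + K) = midx_order J + midx_order K"
  by (cases J; cases K) simp

lemma midx_order_unit [simp]: "midx_order (midx_unit i) = 1"
  by (cases i) auto

lemma finite_midx_order_le: "finite {J. midx_order J \<le> n}"
proof (rule finite_subset)
  show "{J. midx_order J \<le> n} \<subseteq> {..n} \<times> {..n} \<times> {..n}" by auto
qed auto

lemma jet_order_le_mono: "jet_order_le m F \<Longrightarrow> m \<le> n \<Longrightarrow> jet_order_le n F"
  by (auto simp: jet_order_le_def)

lemma jet_order_le_on_jet: "smooth f \<Longrightarrow> jet_order_le n (on_jet f)"
  by (auto simp: jet_order_le_def partial_on_jet) (subst pd_derivative_coord, auto simp: on_jet_def)

lemma jet_order_le_coord: "midx_order J \<le> n \<Longrightarrow> jet_order_le n (\<lambda>p. p (Dep J))"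
  by (auto simp: jet_order_le_def partial_coord)

lemma jet_order_le_add:
  "jet_fun F \<Longrightarrow> jet_fun G \<Longrightarrow> jet_order_le n F \<Longrightarrow> jet_order_le n G \<Longrightarrow> jet_order_le n (\<lambda>p. F p + G p)"
  by (auto simp: jet_order_le_def partial_add)

lemma jet_order_le_diff:
  "jet_fun F \<Longrightarrow> jet_fun G \<Longrightarrow> jet_order_le n F \<Longrightarrow> jet_order_le n G \<Longrightarrow> jet_order_le n (\<lambda>p. F p - G p)"
  by (auto simp: jet_order_le_def partial_diff)

lemma jet_order_le_mult:
  "jet_fun F \<Longrightarrow> jet_fun G \<Longrightarrow> jet_order_le n F \<Longrightarrow> jet_order_le n G \<Longrightarrow> jet_order_le n (\<lambda>p. F p * G p)"
  by (auto simp: jet_order_le_def partial_mult)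

lemma jet_order_le_sum:
  "(\<And>i. i \<in> A \<Longrightarrow> jet_fun (F i) \<and> jet_order_le n (F i)) \<Longrightarrow> jet_order_le n (\<lambda>p. \<Sum>i\<in>A. F i p)"
  by (auto simp: jet_order_le_def partial_sum)

lemma jet_order_common:
  assumes "\<exists>m. jet_order_le m F" "\<exists>n. jet_order_le n G"
  obtains k where "jet_order_le k F" "jet_order_le k G"
proof -
  obtain m n where "jet_order_le m F" "jet_order_le n G" using assms by blast
  then have "jet_order_le (max m n) F" "jet_order_le (max m n) G"
    by (auto elim: jet_order_le_mono)
  then show thesis by (rule that)
qed

lemma jet_fun_finite_order: "jet_fun F \<Longrightarrow> \<exists>n. jet_order_le n F"
proof (induction rule: jet_fun.induct)
  case (jet_fun_add F G)
  from jet_order_common[OF jet_fun_add.IH] jet_order_le_add[OF jet_fun_add.hyps] show ?case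
    by metis
next
  case (jet_fun_mult F G)
  from jet_order_common[OF jet_fun_mult.IH] jet_order_le_mult[OF jet_fun_mult.hyps] show ?case
    by metis
qed (auto intro: jet_order_le_on_jet jet_order_le_coord)

text \<open>
  The total derivative without the order parameter: \<open>total_deriv n\<close> does not depend on \<open>n\<close> as soon
  as \<open>n\<close> bounds the order of the function, and the least such \<open>n\<close> is one choice.
\<close>

definition D :: "indep \<Rightarrow> (jet \<Rightarrow> real) \<Rightarrow> jet \<Rightarrow> real" where
  "D i F = total_deriv (LEAST n. jet_order_le n F) i F"

lemma total_deriv_eq_of_le:
  assumes "jet_order_le m F" "m \<le> n"
  shows "total_deriv n i F = total_deriv m i F"
proof
  fix p
  have "(\<Sum>J | midx_order J \<le> n. p (Dep (J + midx_unit i)) * partial (Dep J) F p) =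
        (\<Sum>J | midx_order J \<le> m. p (Dep (J + midx_unit i)) * partial (Dep J) F p)"
    using assms by (intro sum.mono_neutral_right finite_midx_order_le) (auto simp: jet_order_le_def)
  then show "total_deriv n i F p = total_deriv m i F p" by (simp add: total_deriv_def)
qed

lemma total_deriv_eq_D: "jet_order_le n F \<Longrightarrow> total_deriv n i F = D i F"
  unfolding D_def
  using total_deriv_eq_of_le LeastI[of "\<lambda>n. jet_order_le n F" n] Least_le[of "\<lambda>n. jet_order_le n F" n]
  by blast

lemma D_add:
  assumes "jet_fun F" "jet_fun G"
  shows "D i (\<lambda>p. F p + G p) = (\<lambda>p. D i F p + D i G p)"
proof -
  obtain n where n: "jet_order_le n F" "jet_order_le n G"
    using jet_order_common[OF assms[THEN jet_fun_finite_order]] by blast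
  show ?thesis
    unfolding n[THEN total_deriv_eq_D, symmetric]
      total_deriv_eq_D[OF jet_order_le_add[OF assms n], symmetric]
    by (rule ext) (simp add: total_deriv_def partial_add assms sum.distrib algebra_simps)
qed

lemma D_mult:
  assumes "jet_fun F" "jet_fun G"
  shows "D i (\<lambda>p. F p * G p) = (\<lambda>p. D i F p * G p + F p * D i G p)"
proof -
  obtain n where n: "jet_order_le n F" "jet_order_le n G"
    using jet_order_common[OF assms[THEN jet_fun_finite_order]] by blast
  show ?thesis
    unfolding n[THEN total_deriv_eq_D, symmetric]
      total_deriv_eq_D[OF jet_order_le_mult[OF assms n], symmetric]
    by (rule ext) (simp add: total_deriv_def partial_mult assms sum.distrib sum_distrib_left algebra_simps)
qed

lemma D_const: "D i (\<lambda>_. c) = (\<lambda>_. 0)"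
  by (rule ext) (simp add: D_def total_deriv_def partial_const)

lemma D_minus: "jet_fun F \<Longrightarrow> D i (\<lambda>p. - F p) = (\<lambda>p. - D i F p)"
  using D_mult[OF jet_fun_const[of "-1"], of F i] by (simp add: D_const)

lemma D_diff:
  assumes "jet_fun F" "jet_fun G"
  shows "D i (\<lambda>p. F p - G p) = (\<lambda>p. D i F p - D i G p)"
  using D_add[OF assms(1) jet_fun_minus[OF assms(2)]] by (simp add: D_minus assms)

lemma D_sum:
  "(\<And>k. k \<in> A \<Longrightarrow> jet_fun (F k)) \<Longrightarrow> D i (\<lambda>p. \<Sum>k\<in>A. F k p) = (\<lambda>p. \<Sum>k\<in>A. D i (F k) p)"
  by (induction A rule: infinite_finite_induct)
     (simp_all add: D_const D_add jet_fun_sum)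

lemma D_coord: "D i (\<lambda>p. p (Dep J)) = (\<lambda>p. p (Dep (J + midx_unit i)))"
  unfolding total_deriv_eq_D[OF jet_order_le_coord[OF order_refl], symmetric]
  by (intro ext) (simp add: total_deriv_def partial_coord mult_delta_right finite_midx_order_le)

lemma D_on_jet:
  assumes "smooth f"
  shows "D i (on_jet f) =
    (\<lambda>p. on_jet (pd (Ind i) f) p + p (Dep (midx_unit i)) * on_jet (pd (Dep (0, 0, 0)) f) p)"
proof -
  have "{J. midx_order J = 0} = {(0, 0, 0)}" by auto
  moreover have "(0, 0, 0) + midx_unit i = midx_unit i" by (cases i) auto
  ultimately show ?thesis
    unfolding total_deriv_eq_D[OF jet_order_le_on_jet[OF assms, of 0], symmetric]
    by (intro ext) (simp add: total_deriv_def partial_on_jet assms)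
qed

lemmas D_simps = D_on_jet D_coord D_const D_add D_diff D_minus D_mult

lemma jet_fun_D: "jet_fun F \<Longrightarrow> jet_fun (D i F)"
  by (induction rule: jet_fun.induct) (simp_all add: D_simps jet_fun_intros smooth_pd)

text \<open>
  The commutator \<open>[\<partial>/\<partial>h\<^sub>K, D\<^sub>i] = \<partial>/\<partial>h\<^bsub>K-i\<^esub>\<close>, which comes from the summand \<open>h\<^sub>K \<partial>/\<partial>h\<^bsub>K-i\<^esub>\<close> of \<open>D\<^sub>i\<close>.  For
  functions of the base it rests on the symmetry of second derivatives.
\<close>

lemma partial_Dep_D:
  "jet_fun F \<Longrightarrow> partial (Dep K) (D i F) =
    (\<lambda>p. D i (partial (Dep K) F) p + (if midx_unit i \<le> K then partial (Dep (K - midx_unit i)) F p else 0))"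
proof (induction rule: jet_fun.induct)
  case (jet_fun_on_jet f)
  have "(if midx_unit i \<le> K then on_jet (pd (Dep (K - midx_unit i)) f) p else 0) =
        (if Dep (midx_unit i) = Dep K then on_jet (pd (Dep (0, 0, 0)) f) p else 0)" for p
  proof (cases "midx_unit i = K")
    case True
    then have "K - midx_unit i = (0, 0, 0)" by (cases i) (auto simp: zero_prod_def)
    with True show ?thesis by simp
  next
    case False
    then have "midx_unit i \<le> K \<Longrightarrow> K - midx_unit i \<noteq> (0, 0, 0)"
      by (cases K; cases i) auto
    then show ?thesis using False by (simp add: pd_derivative_coord jet_fun_on_jet) (simp add: on_jet_def)
  qed
  then show ?case
    unfolding partial_on_jet[OF jet_fun_on_jet]
    by (intro ext)
       (simp add: D_on_jet partial_simps jet_fun_intros smooth_pd jet_fun_on_jet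
          pd_commute[OF jet_fun_on_jet, of "Dep K" "Ind i"]
          pd_commute[OF jet_fun_on_jet, of "Dep K" "Dep (0, 0, 0)"])
next
  case (jet_fun_coord J)
  have "J + midx_unit i = K \<longleftrightarrow> midx_unit i \<le> K \<and> J = K - midx_unit i"
    by (cases J; cases K; cases i) auto
  then show ?case by (simp add: D_coord D_const partial_coord fun_eq_iff)
next
  case (jet_fun_add F G)
  then show ?case
    by (intro ext) (simp add: D_add D_mult partial_add partial_mult jet_fun_intros jet_fun_D
        jet_fun_partial algebra_simps)
next
  case (jet_fun_mult F G)
  show ?case
    by (intro ext)
       (simp add: D_add D_mult partial_add partial_mult jet_fun_mult jet_fun_intros jet_fun_D
          jet_fun_partial distrib_left distrib_right)
qed

text \<open>
  The commutator in a form without subtraction of multi-indices, suitable for rewriting.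
\<close>

lemma partial_Dep_D_cases:
  assumes "jet_fun F"
  shows "partial (Dep (0, b, c)) (D X F) = D X (partial (Dep (0, b, c)) F)"
    and "partial (Dep (a, 0, c)) (D Y F) = D Y (partial (Dep (a, 0, c)) F)"
    and "partial (Dep (a, b, 0)) (D T F) = D T (partial (Dep (a, b, 0)) F)"
    and "partial (Dep (Suc a, b, c)) (D X F) =
      (\<lambda>p. D X (partial (Dep (Suc a, b, c)) F) p + partial (Dep (a, b, c)) F p)"
    and "partial (Dep (a, Suc b, c)) (D Y F) =
      (\<lambda>p. D Y (partial (Dep (a, Suc b, c)) F) p + partial (Dep (a, b, c)) F p)"
    and "partial (Dep (a, b, Suc c)) (D T F) =
      (\<lambda>p. D T (partial (Dep (a, b, Suc c)) F) p + partial (Dep (a, b, c)) F p)"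
  using partial_Dep_D[OF assms] by simp_all

lemmas partial_Dep_D_numeral =
  partial_Dep_D_cases(4)[of F "pred_numeral n", folded numeral_eq_Suc]
  partial_Dep_D_cases(5)[of F _ "pred_numeral n", folded numeral_eq_Suc]
  partial_Dep_D_cases(6)[of F _ _ "pred_numeral n", folded numeral_eq_Suc] for F n

lemma jet_order_le_D:
  assumes "jet_fun F" "jet_order_le n F"
  shows "jet_order_le (Suc n) (D i F)"
  unfolding jet_order_le_def
proof (intro allI impI)
  fix J assume J: "Suc n < midx_order J"
  have "n < midx_order (J - midx_unit i)"
    using J by (cases J; cases i) auto
  with J assms(2) have "partial (Dep (J - midx_unit i)) F = (\<lambda>_. 0)" "partial (Dep J) F = (\<lambda>_. 0)"
    by (simp_all add: jet_order_le_def del: midx_order.simps split_paired_All)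
  then show "partial (Dep J) (D i F) = (\<lambda>_. 0)"
    by (simp add: partial_Dep_D assms D_const if_distrib cong: if_cong)
qed

section \<open>Prolongation coefficients in terms of the characteristic\<close>

text \<open>
  Total derivatives are applied in the order in which \<open>prolong_coeff\<close> uses up a multi-index.
\<close>

fun D_multi :: "multi_index \<Rightarrow> (jet \<Rightarrow> real) \<Rightarrow> jet \<Rightarrow> real" where
  "D_multi (i, j, k) F = (D X ^^ i) ((D Y ^^ j) ((D T ^^ k) F))"

lemma jet_fun_D_pow: "jet_fun F \<Longrightarrow> jet_fun ((D i ^^ n) F)"
  by (induction n) (auto intro: jet_fun_D)

lemma jet_fun_D_multi: "jet_fun F \<Longrightarrow> jet_fun (D_multi J F)"
  by (cases J) (simp add: jet_fun_D_pow)

definition characteristic :: "vector_field \<Rightarrow> jet \<Rightarrow> real" where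
  "characteristic V p =
     on_jet (phi V) p - (\<Sum>i\<in>{X, Y, T}. on_jet (xi V i) p * p (Dep (midx_unit i)))"

text \<open>
  The part \<open>\<Sum>i. \<xi>\<^sup>i h\<^bsub>J,i\<^esub>\<close> of a prolongation coefficient, due to the motion of the independent
  variables.
\<close>

definition transport :: "vector_field \<Rightarrow> multi_index \<Rightarrow> jet \<Rightarrow> real" where
  "transport V J p = (\<Sum>i\<in>{X, Y, T}. on_jet (xi V i) p * p (Dep (J + midx_unit i)))"

context
  fixes V assumes smooth_V: "smooth_vector_field V"
begin

lemma smooth_coeffs: "smooth (xi V i)" "smooth (phi V)"
  using smooth_V by (auto simp: smooth_vector_field_def)

lemma jet_fun_transport: "jet_fun (transport V J)"
  unfolding transport_def by (intro jet_fun_intros smooth_coeffs)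

lemma jet_fun_characteristic: "jet_fun (characteristic V)"
  unfolding characteristic_def by (intro jet_fun_intros smooth_coeffs)

lemma D_transport:
  "D k (transport V J) =
    (\<lambda>p. (\<Sum>i\<in>{X, Y, T}. D k (on_jet (xi V i)) p * p (Dep (J + midx_unit i)))
         + transport V (J + midx_unit k) p)"
proof -
  have "jet_fun (\<lambda>p. on_jet (xi V i) p * p (Dep (J + midx_unit i)))" for i
    by (intro jet_fun_intros smooth_coeffs)
  moreover have "J + midx_unit k + midx_unit i = J + midx_unit i + midx_unit k" for i
    by (simp add: add_ac)
  ultimately show ?thesis
    unfolding transport_def
    by (subst D_sum, simp, intro ext)
       (simp only: D_mult jet_fun_on_jet smooth_coeffs jet_fun_coord D_coord sum.distrib)
qed

text \<open>
  The correction \<open>- (\<Sum>i. (D\<^sub>k \<xi>\<^sup>i) h\<^bsub>J,i\<^esub>)\<close> in the recursion cancels exactly the terms in which \<open>D\<^sub>k\<close>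
  hits \<open>\<xi>\<^sup>i\<close> in the transport part; the rest is differentiated freely.  The bound on the order is
  carried along because \<open>prolong_step\<close> uses a total derivative of prescribed order.
\<close>

lemma prolong_step_D:
  assumes R: "jet_fun R" and P: "P = (\<lambda>p. R p + transport V J p)" and ord: "jet_order_le (midx_order J) P"
  shows "prolong_step V J k P = (\<lambda>p. D k R p + transport V (J + midx_unit k) p)"
    and "jet_order_le (midx_order (J + midx_unit k)) (prolong_step V J k P)"
proof -
  have jP: "jet_fun P" unfolding P by (intro jet_fun_intros R jet_fun_transport)
  have step: "prolong_step V J k P =
      (\<lambda>p. D k P p - (\<Sum>i\<in>{X, Y, T}. D k (on_jet (xi V i)) p * p (Dep (J + midx_unit i))))"
    unfolding prolong_step_def
    by (simp only: total_deriv_eq_D[OF ord] total_deriv_eq_D[OF jet_order_le_on_jet[OF smooth_coeffs(1)]])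
  show "prolong_step V J k P = (\<lambda>p. D k R p + transport V (J + midx_unit k) p)"
    unfolding step unfolding P D_add[OF R jet_fun_transport] D_transport by simp
  have "jet_order_le (Suc (midx_order J)) (\<lambda>p. D k (on_jet (xi V i)) p * p (Dep (J + midx_unit i)))" for i
    by (intro jet_order_le_mult jet_fun_D jet_fun_on_jet jet_fun_coord jet_order_le_coord
        jet_order_le_D jet_order_le_on_jet smooth_coeffs) simp
  then show "jet_order_le (midx_order (J + midx_unit k)) (prolong_step V J k P)"
    unfolding step midx_order_add midx_order_unit Suc_eq_plus1[symmetric]
    by (intro jet_order_le_diff jet_order_le_sum jet_fun_intros jet_fun_D jP jet_order_le_D ord
        smooth_coeffs conjI)
qed

lemma prolong_coeff_eq_and_order:
  "prolong_coeff V J = (\<lambda>p. D_multi J (characteristic V) p + transport V J p)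
   \<and> jet_order_le (midx_order J) (prolong_coeff V J)" (is "?P J")
proof -
  have step: "?P K"
    if "?P J" "K = J + midx_unit i" "prolong_coeff V K = prolong_step V J i (prolong_coeff V J)"
      "D_multi K (characteristic V) = D i (D_multi J (characteristic V))" for J K i
    using that(1) prolong_step_D[OF jet_fun_D_multi[OF jet_fun_characteristic, of J], of "prolong_coeff V J" J i]
    unfolding that(3,4) unfolding that(2) by blast
  have "?P (0, 0, k)" for k
  proof (induction k)
    case 0
    then show ?case
      by (auto simp: characteristic_def transport_def jet_order_le_on_jet smooth_coeffs)
  next
    case (Suc k)
    show ?case by (rule step[OF Suc, of _ T]) simp_all
  qed
  note T_powers = this
  have "?P (0, j, k)" for j k
  proof (induction j)
    case 0
    show ?case by (rule T_powers)
  next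
    case (Suc j)
    show ?case by (rule step[OF Suc, of _ Y]) simp_all
  qed
  note YT_powers = this
  have "?P (i, j, k)" for i j k
  proof (induction i)
    case 0
    show ?case by (rule YT_powers)
  next
    case (Suc i)
    show ?case by (rule step[OF Suc, of _ X]) simp_all
  qed
  then show ?thesis by (cases J) blast
qed

lemma prolong_coeff_eq:
  "prolong_coeff V J = (\<lambda>p. D_multi J (characteristic V) p + transport V J p)"
  using prolong_coeff_eq_and_order by blast

lemma jet_fun_prolong_coeff: "jet_fun (prolong_coeff V J)"
  unfolding prolong_coeff_eq
  by (intro jet_fun_intros jet_fun_D_multi jet_fun_characteristic jet_fun_transport)

end

text \<open>
  The definition as an equation between functions, which is the form needed under \<open>partial\<close>.
\<close>

lemma kuramoto_sivashinsky_eq: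
  "kuramoto_sivashinsky \<nu> \<kappa> lam = (\<lambda>p.
     p (Dep (0, 0, 1)) - \<nu> * (p (Dep (2, 0, 0)) + p (Dep (0, 2, 0)))
     + \<kappa> * (p (Dep (4, 0, 0)) + 2 * p (Dep (2, 2, 0)) + p (Dep (0, 4, 0)))
     - lam * ((p (Dep (1, 0, 0)))^2 + (p (Dep (0, 1, 0)))^2))"
  by (rule ext) (rule kuramoto_sivashinsky_def)

lemma jet_fun_ks: "jet_fun (kuramoto_sivashinsky \<nu> \<kappa> lam)"
  unfolding kuramoto_sivashinsky_eq by (intro jet_fun_intros)

lemma partial_ks:
  "partial c (kuramoto_sivashinsky \<nu> \<kappa> lam) = (\<lambda>p.
     (if c = Dep (0, 0, 1) then 1 else 0)
     + (if c = Dep (2, 0, 0) then - \<nu> else 0) + (if c = Dep (0, 2, 0) then - \<nu> else 0)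
     + (if c = Dep (4, 0, 0) then \<kappa> else 0) + (if c = Dep (2, 2, 0) then 2 * \<kappa> else 0)
     + (if c = Dep (0, 4, 0) then \<kappa> else 0)
     + (if c = Dep (1, 0, 0) then - 2 * lam * p (Dep (1, 0, 0)) else 0)
     + (if c = Dep (0, 1, 0) then - 2 * lam * p (Dep (0, 1, 0)) else 0))"
  unfolding kuramoto_sivashinsky_eq
  by (intro ext) (simp add: partial_simps jet_fun_intros power2_eq_square)

lemma prolongation_ks:
  "prolongation 4 V (kuramoto_sivashinsky \<nu> \<kappa> lam) = (\<lambda>p.
     prolong_coeff V (0, 0, 1) p
     - \<nu> * (prolong_coeff V (2, 0, 0) p + prolong_coeff V (0, 2, 0) p)
     + \<kappa> * (prolong_coeff V (4, 0, 0) p + 2 * prolong_coeff V (2, 2, 0) p + prolong_coeff V (0, 4, 0) p)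
     - 2 * lam * (p (Dep (1, 0, 0)) * prolong_coeff V (1, 0, 0) p
                  + p (Dep (0, 1, 0)) * prolong_coeff V (0, 1, 0) p))"
proof
  fix p
  have delta: "(\<Sum>J | midx_order J \<le> 4. prolong_coeff V J p * (if Dep J = Dep K then a else 0))
      = prolong_coeff V K p * a" if "midx_order K \<le> 4" for K a
    using that by (simp add: finite_midx_order_le mult_delta_right del: midx_order.simps prolong_coeff.simps)
  show "prolongation 4 V (kuramoto_sivashinsky \<nu> \<kappa> lam) p =
     prolong_coeff V (0, 0, 1) p
     - \<nu> * (prolong_coeff V (2, 0, 0) p + prolong_coeff V (0, 2, 0) p)
     + \<kappa> * (prolong_coeff V (4, 0, 0) p + 2 * prolong_coeff V (2, 2, 0) p + prolong_coeff V (0, 4, 0) p)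
     - 2 * lam * (p (Dep (1, 0, 0)) * prolong_coeff V (1, 0, 0) p
                  + p (Dep (0, 1, 0)) * prolong_coeff V (0, 1, 0) p)"
    unfolding prolongation_def partial_ks distrib_left sum.distrib
    by (subst delta, simp)+ (simp add: algebra_simps del: prolong_coeff.simps)
qed

section \<open>Affine functions of \<open>(x, y, t, h)\<close>\<close>

definition affine_fun ::
    "real \<Rightarrow> real \<Rightarrow> real \<Rightarrow> real \<Rightarrow> real \<Rightarrow> real \<times> real \<times> real \<times> real \<Rightarrow> real" where
  "affine_fun a b c d e = (\<lambda>(x, y, t, h). a * x + b * y + c * t + d * h + e)"

lemma affine_has_derivative: "(affine_fun a b c d e has_derivative affine_fun a b c d 0) (at z)"
  unfolding affine_fun_def case_prod_unfold
  by (auto intro!: derivative_eq_intros)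

lemma smooth_affine: "smooth (affine_fun a b c d e)"
proof -
  have "bounded_linear (affine_fun a b c d 0)"
    using affine_has_derivative by (rule has_derivative_bounded_linear)
  from smooth_bounded_linear_plus_const[OF this, of e] show ?thesis
    by (simp add: affine_fun_def case_prod_unfold)
qed

lemma dird_affine: "dird v (affine_fun a b c d e) = (\<lambda>_. affine_fun a b c d 0 v)"
  by (rule ext) (rule dird_eqI[OF affine_has_derivative])

lemma pd_affine:
  "pd (Ind X) (affine_fun a b c d e) = (\<lambda>_. a)" "pd (Ind Y) (affine_fun a b c d e) = (\<lambda>_. b)"
  "pd (Ind T) (affine_fun a b c d e) = (\<lambda>_. c)" "pd (Dep (0, 0, 0)) (affine_fun a b c d e) = (\<lambda>_. d)"
  by (simp_all add: pd_def dird_affine) (simp_all add: affine_fun_def)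

lemma affine_of_gradient_const:
  assumes f: "smooth f"
    and "pd (Ind X) f = (\<lambda>_. a)" "pd (Ind Y) f = (\<lambda>_. b)" "pd (Ind T) f = (\<lambda>_. c)"
      "pd (Dep (0, 0, 0)) f = (\<lambda>_. d)"
  shows "\<exists>e. f = affine_fun a b c d e"
proof -
  have "dird v f z = affine_fun a b c d 0 v" for v z
  proof -
    let ?w = "fst v *\<^sub>R coord_axis (Ind X) + fst (snd v) *\<^sub>R coord_axis (Ind Y)
        + fst (snd (snd v)) *\<^sub>R coord_axis (Ind T) + snd (snd (snd v)) *\<^sub>R coord_axis (Dep (0, 0, 0))"
    have w: "?w = v"
      by (cases v) simp
    have "dird ?w f z = affine_fun a b c d 0 v"
      unfolding linear_add[OF dird_linear[OF f]] linear_scale[OF dird_linear[OF f]]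
        assms(2-)[unfolded pd_def]
      by (simp add: affine_fun_def case_prod_unfold)
    then show ?thesis by (simp only: w)
  qed
  then have deriv: "(f has_derivative affine_fun a b c d 0) (at z)" for z
    using smooth_has_derivative[OF f, of z] by (simp only:)
  from has_derivative_diff[OF deriv affine_has_derivative[of a b c d 0]]
  have "((\<lambda>z. f z - affine_fun a b c d 0 z) has_derivative (\<lambda>_. 0)) (at z within UNIV)" for z
    by simp
  then have const: "f z - affine_fun a b c d 0 z = f 0 - affine_fun a b c d 0 0" for z
    using has_derivative_zero_unique[of UNIV "\<lambda>z. f z - affine_fun a b c d 0 z" 0 z] by simp
  have "f = affine_fun a b c d (f 0)"
  proof
    fix z
    show "f z = affine_fun a b c d (f 0) z"
      using const[of z] by (simp add: affine_fun_def case_prod_unfold)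
  qed
  then show ?thesis by (rule exI)
qed

lemma const_of_gradient_zero:
  assumes "smooth f" "pd (Ind X) f = (\<lambda>_. 0)" "pd (Ind Y) f = (\<lambda>_. 0)" "pd (Ind T) f = (\<lambda>_. 0)"
      "pd (Dep (0, 0, 0)) f = (\<lambda>_. 0)"
  shows "\<exists>c. f = (\<lambda>_. c)"
  using affine_of_gradient_const[OF assms] by (auto simp: affine_fun_def)

lemma D_multi_expand:
  "D_multi (1, 0, 0) F = D X F" "D_multi (0, 1, 0) F = D Y F" "D_multi (0, 0, 1) F = D T F"
  "D_multi (2, 0, 0) F = D X (D X F)" "D_multi (0, 2, 0) F = D Y (D Y F)"
  "D_multi (4, 0, 0) F = D X (D X (D X (D X F)))"
  "D_multi (2, 2, 0) F = D X (D X (D Y (D Y F)))"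
  "D_multi (0, 4, 0) F = D Y (D Y (D Y (D Y F)))"
  by (simp_all add: eval_nat_numeral)

section \<open>The determining equations\<close>

lemma on_jet_const: "on_jet (\<lambda>_. c) = (\<lambda>_. c)"
  by (simp add: on_jet_def fun_eq_iff)

lemma pd_divide: "smooth f \<Longrightarrow> pd c (\<lambda>z. f z / a) = (\<lambda>z. pd c f z / a)"
  unfolding pd_def
  by (rule ext, rule dird_eqI)
    (rule bounded_linear.has_derivative[OF bounded_linear_divide] smooth_has_derivative | assumption)+

lemma pd_minus: "smooth f \<Longrightarrow> pd c (\<lambda>z. - f z) = (\<lambda>z. - pd c f z)"
  unfolding pd_def
  by (rule ext, rule dird_eqI) (rule has_derivative_minus smooth_has_derivative | assumption)+

lemma pd_minus_divide: "smooth f \<Longrightarrow> pd c (\<lambda>z. - (f z / a)) = (\<lambda>z. - (pd c f z / a))"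
  unfolding pd_def
  by (rule ext, rule dird_eqI)
     (rule has_derivative_minus bounded_linear.has_derivative[OF bounded_linear_divide] smooth_has_derivative | assumption)+

locale ks_symmetry =
  fixes \<nu> \<kappa> lam :: real and V
  assumes nz: "\<nu> \<noteq> 0" "\<kappa> \<noteq> 0" "lam \<noteq> 0"
    and V: "V \<in> ks_symmetry_algebra \<nu> \<kappa> lam"
begin

abbreviation "KS \<equiv> kuramoto_sivashinsky \<nu> \<kappa> lam"
abbreviation "E \<equiv> prolongation 4 V KS"

lemma V_smooth: "smooth_vector_field V"
  using V by (simp add: ks_symmetry_algebra_def)

lemmas V_coeffs [simp] = smooth_coeffs[OF V_smooth]
lemmas V_jet [simp] = jet_fun_prolong_coeff[OF V_smooth]

lemma jet_fun_E: "jet_fun E"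
  unfolding prolongation_ks by (intro jet_fun_intros V_jet)

text \<open>
  Since \<open>E\<close> is only known to vanish on the equation, a derivative of \<open>E\<close> in a jet coordinate is
  known up to the multiple of \<open>\<partial>E/\<partial>h\<^sub>t\<close> that compensates the change of \<open>h\<^sub>t\<close>.
\<close>

lemma partial_E_on_solutions:
  assumes "KS p = 0" "J \<noteq> (0, 0, 1)"
  shows "partial (Dep J) E p = partial (Dep J) KS p * partial (Dep (0, 0, 1)) E p"
proof (rule tangent_to_hypersurface[OF jet_fun_E jet_fun_ks _ _ assms(1)])
  show "E p = 0" if "KS p = 0" for p
    using V that by (simp add: ks_symmetry_algebra_def)
qed (use assms in \<open>simp_all add: kuramoto_sivashinsky_def\<close>)

abbreviation "Q \<equiv> characteristic V"
abbreviation "\<xi> \<equiv> \<lambda>i. on_jet (xi V i)"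
abbreviation "h_coord \<equiv> Dep (0, 0, 0)"

lemma jet_fun_Q [simp]: "jet_fun Q"
  by (rule jet_fun_characteristic[OF V_smooth])

lemma partial_transport:
  "J \<noteq> (0, 0, 0) \<Longrightarrow> partial (Dep J) (transport V K) =
     (\<lambda>p. \<Sum>i\<in>{X, Y, T}. \<xi> i p * (if K + midx_unit i = J then 1 else 0))"
  unfolding transport_def
  by (subst partial_sum) (simp_all add: partial_simps jet_fun_intros pd_derivative_coord
      del: midx_unit.simps, simp add: on_jet_def)

lemma partial_Q:
  "J \<noteq> (0, 0, 0) \<Longrightarrow> partial (Dep J) Q =
     (\<lambda>p. - (\<Sum>i\<in>{X, Y, T}. \<xi> i p * (if midx_unit i = J then 1 else 0)))"
  unfolding characteristic_def
  by (subst partial_diff) (simp_all add: partial_simps jet_fun_intros pd_derivative_coord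
      del: midx_unit.simps, auto simp: on_jet_def)

lemmas jet_closed [simp] = jet_fun_intros jet_fun_D jet_fun_partial smooth_pd

lemma partial_E: "partial c E = (\<lambda>p. partial c (prolong_coeff V (0, 0, 1)) p
     - \<nu> * (partial c (prolong_coeff V (2, 0, 0)) p + partial c (prolong_coeff V (0, 2, 0)) p)
     + \<kappa> * (partial c (prolong_coeff V (4, 0, 0)) p + 2 * partial c (prolong_coeff V (2, 2, 0)) p
         + partial c (prolong_coeff V (0, 4, 0)) p)
     - 2 * lam * (p (Dep (1, 0, 0)) * partial c (prolong_coeff V (1, 0, 0)) p
                  + p (Dep (0, 1, 0)) * partial c (prolong_coeff V (0, 1, 0)) p)
     - 2 * lam * ((if c = Dep (1, 0, 0) then prolong_coeff V (1, 0, 0) p else 0)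
                  + (if c = Dep (0, 1, 0) then prolong_coeff V (0, 1, 0) p else 0)))"
  unfolding prolongation_ks
  by (intro ext) (simp add: partial_simps algebra_simps del: prolong_coeff.simps D_multi.simps)

lemma partial_prolong: "partial c (prolong_coeff V J) p = partial c (D_multi J Q) p + partial c (transport V J) p"
  unfolding prolong_coeff_eq[OF V_smooth]
  by (subst partial_add) (simp_all add: jet_fun_transport V_smooth jet_fun_D_multi)

(* Multi-indices are normalised to contain Suc 0 in place of 1, so the rewrite rules must, too. *)
lemmas partial_E_expand = partial_E partial_prolong partial_transport partial_Q partial_Dep_D_cases
  partial_Dep_D_numeral D_multi_expand[simplified One_nat_def] zero_prod_def
  D_add D_diff D_mult D_const D_minus

text \<open>
  Pushing \<open>\<partial>/\<partial>h\<^sub>K\<close> through the four total derivatives of the fourth-order terms, the summands that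
  survive are those in which it has lost all of \<open>K\<close> or all but one entry.
\<close>

lemma partial_E_fourth:
  shows "partial (Dep (3, 0, 1)) E p = - 4 * \<kappa> * D X (\<xi> T) p"
    and "partial (Dep (0, 3, 1)) E p = - 4 * \<kappa> * D Y (\<xi> T) p"
    and "partial (Dep (4, 0, 0)) E p = \<kappa> * (partial h_coord Q p - 4 * D X (\<xi> X) p)"
    and "partial (Dep (0, 4, 0)) E p = \<kappa> * (partial h_coord Q p - 4 * D Y (\<xi> Y) p)"
    and "partial (Dep (3, 1, 0)) E p = - 4 * \<kappa> * (D X (\<xi> Y) p + D Y (\<xi> X) p)"
  by (simp_all add: partial_E_expand algebra_simps del: prolong_coeff.simps D_multi.simps)

lemma partial_E_third:
  shows "partial (Dep (3, 0, 0)) E p =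
      \<kappa> * (4 * D X (partial h_coord Q) p - 6 * D X (D X (\<xi> X)) p - 2 * D Y (D Y (\<xi> X)) p)"
    and "partial (Dep (0, 3, 0)) E p =
      \<kappa> * (4 * D Y (partial h_coord Q) p - 6 * D Y (D Y (\<xi> Y)) p - 2 * D X (D X (\<xi> Y)) p)"
  by (simp_all add: partial_E_expand algebra_simps del: prolong_coeff.simps D_multi.simps)

text \<open>
  A jet on the equation with prescribed base point, \<open>h\<^sub>x = a\<close> and \<open>h\<^sub>y = b\<close>: the other derivatives
  vanish, except that the equation determines \<open>h\<^sub>t\<close>.
\<close>

definition jet_at :: "real \<times> real \<times> real \<times> real \<Rightarrow> real \<Rightarrow> real \<Rightarrow> jet" where
  "jet_at z a b = (\<lambda>_. 0)
     (Ind X := fst z, Ind Y := fst (snd z), Ind T := fst (snd (snd z)), h_coord := snd (snd (snd z)),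
      Dep (1, 0, 0) := a, Dep (0, 1, 0) := b, Dep (0, 0, 1) := lam * (a\<^sup>2 + b\<^sup>2))"

lemma on_jet_at [simp]: "on_jet f (jet_at z a b) = f z"
  by (simp add: on_jet_def jet_at_def)

lemma KS_jet_at [simp]: "KS (jet_at z a b) = 0"
  by (simp add: kuramoto_sivashinsky_def jet_at_def)

lemma jet_at_coord:
  "jet_at z a b (Dep (i, j, k)) =
    (if (i, j, k) = (0, 0, 0) then snd (snd (snd z)) else if (i, j, k) = (1, 0, 0) then a
     else if (i, j, k) = (0, 1, 0) then b else if (i, j, k) = (0, 0, 1) then lam * (a\<^sup>2 + b\<^sup>2) else 0)"
  by (simp add: jet_at_def)

text \<open>
  A total derivative in space of a function of the base is affine in a first derivative of \<open>h\<close>,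
  which is free on the equation, so one equation for \<open>D\<^sub>i f\<close> splits into two for \<open>f\<close>.
\<close>

lemma D_on_solutions:
  assumes f: "smooth f" and i: "i = X \<or> i = Y" and eq: "\<And>p. KS p = 0 \<Longrightarrow> D i (on_jet f) p = on_jet g p"
  shows "pd (Ind i) f = g" and "pd h_coord f = (\<lambda>_. 0)"
proof -
  have *: "pd (Ind i) f z + a * pd h_coord f z = g z" for z a
    using i eq[of "jet_at z a a"] by (auto simp: D_on_jet f jet_at_coord)
  show "pd (Ind i) f = g" using *[of _ 0] by auto
  then show "pd h_coord f = (\<lambda>_. 0)" using *[of _ 1] by auto
qed

text \<open>
  The coordinates \<open>h\<^bsub>xxxt\<^esub>\<close> and \<open>h\<^bsub>yyyt\<^esub>\<close> do not occur in the equation, so the derivative of \<open>E\<close> in them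
  vanishes.
\<close>

lemma xi_T_gradient: "pd (Ind X) (xi V T) = (\<lambda>_. 0)" "pd (Ind Y) (xi V T) = (\<lambda>_. 0)" "pd h_coord (xi V T) = (\<lambda>_. 0)"
proof -
  have "D i (\<xi> T) p = on_jet (\<lambda>_. 0) p" if "KS p = 0" "i = X \<or> i = Y" for p i
    using that partial_E_on_solutions[OF that(1), of "(3, 0, 1)"] partial_E_on_solutions[OF that(1), of "(0, 3, 1)"] nz
    by (auto simp: partial_E_fourth partial_ks on_jet_const simp del: One_nat_def)
  then show "pd (Ind X) (xi V T) = (\<lambda>_. 0)" "pd (Ind Y) (xi V T) = (\<lambda>_. 0)" "pd h_coord (xi V T) = (\<lambda>_. 0)"
    using D_on_solutions[of "xi V T" _ "\<lambda>_. 0"] by auto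
qed

lemma D_xi_T: "D X (\<xi> T) = (\<lambda>_. 0)" "D Y (\<xi> T) = (\<lambda>_. 0)" "D T (\<xi> T) = on_jet (pd (Ind T) (xi V T))"
  by (simp_all add: D_on_jet xi_T_gradient on_jet_const)

lemma partial_E_t: "partial (Dep (0, 0, 1)) E p = partial h_coord Q p - on_jet (pd (Ind T) (xi V T)) p"
  by (simp add: partial_E_expand D_xi_T algebra_simps del: prolong_coeff.simps D_multi.simps)

text \<open>
  From \<open>h\<^bsub>xxxx\<^esub>\<close> and \<open>h\<^bsub>yyyy\<^esub>\<close>: the unknown \<open>\<partial>Q/\<partial>h\<close> occurs on both sides of the tangency relation and
  cancels, and what remains compares the scaling of space with that of time.
\<close>

lemma xi_diagonal:
  "pd (Ind X) (xi V X) = (\<lambda>z. pd (Ind T) (xi V T) z / 4)" "pd h_coord (xi V X) = (\<lambda>_. 0)"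
  "pd (Ind Y) (xi V Y) = (\<lambda>z. pd (Ind T) (xi V T) z / 4)" "pd h_coord (xi V Y) = (\<lambda>_. 0)"
proof -
  have "D X (\<xi> X) p = on_jet (\<lambda>z. pd (Ind T) (xi V T) z / 4) p"
       "D Y (\<xi> Y) p = on_jet (\<lambda>z. pd (Ind T) (xi V T) z / 4) p" if "KS p = 0" for p
    using that partial_E_on_solutions[OF that(1), of "(4, 0, 0)"] partial_E_on_solutions[OF that(1), of "(0, 4, 0)"] nz
    by (auto simp: partial_E_fourth partial_ks partial_E_t simp del: One_nat_def) (auto simp: on_jet_def)
  then show "pd (Ind X) (xi V X) = (\<lambda>z. pd (Ind T) (xi V T) z / 4)" "pd h_coord (xi V X) = (\<lambda>_. 0)"
  "pd (Ind Y) (xi V Y) = (\<lambda>z. pd (Ind T) (xi V T) z / 4)" "pd h_coord (xi V Y) = (\<lambda>_. 0)"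
    using D_on_solutions[of "xi V X" X] D_on_solutions[of "xi V Y" Y] by auto
qed

lemma pd_h_xi: "pd h_coord (xi V i) = (\<lambda>_. 0)"
  by (cases i) (simp_all add: xi_diagonal xi_T_gradient)

lemma D_xi: "D i (\<xi> k) = on_jet (pd (Ind i) (xi V k))"
  by (simp add: D_on_jet pd_h_xi on_jet_const)

text \<open>
  From \<open>h\<^bsub>xxxy\<^esub>\<close>; together with \<open>xi_diagonal\<close> this is the conformal Killing equation of the plane
  with a factor that depends on \<open>t\<close> only.
\<close>

lemma xi_antisymmetric: "pd (Ind X) (xi V Y) = (\<lambda>z. - pd (Ind Y) (xi V X) z)"
proof
  fix z
  show "pd (Ind X) (xi V Y) z = - pd (Ind Y) (xi V X) z"
    using partial_E_on_solutions[of "jet_at z 0 0" "(3, 1, 0)"] nz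
    by (simp add: partial_E_fourth partial_ks D_xi del: One_nat_def)
qed

lemma pd_T_xi_T_flat: "i \<noteq> T \<Longrightarrow> pd (Ind i) (pd (Ind T) (xi V T)) = (\<lambda>_. 0)"
  using pd_commute[of "xi V T" "Ind i" "Ind T"] xi_T_gradient by (cases i) (simp_all add: pd_const)

text \<open>
  A conformal Killing field whose factor is constant in space is affine: each second derivative in
  space of \<open>\<xi>\<close> or \<open>\<eta>\<close> can be turned, by the two relations above and exchange of derivatives, into a spatial derivative
  of \<open>\<tau>\<^sub>t\<close>.
\<close>

lemma xi_second_derivs:
  assumes "i \<noteq> T" "j \<noteq> T"
  shows "pd (Ind i) (pd (Ind j) (xi V k)) = (\<lambda>_. 0)"
proof -
  note simps = xi_diagonal xi_antisymmetric xi_T_gradient pd_minus pd_divide smooth_pd V_coeffs pd_T_xi_T_flat pd_const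
  have XX: "pd (Ind i) (pd (Ind X) (xi V X)) = (\<lambda>_. 0)" "pd (Ind i) (pd (Ind Y) (xi V Y)) = (\<lambda>_. 0)"
    if "i \<noteq> T" for i using that by (simp_all add: simps)
  have 1: "pd (Ind X) (pd (Ind Y) (xi V X)) = (\<lambda>_. 0)" "pd (Ind Y) (pd (Ind X) (xi V Y)) = (\<lambda>_. 0)"
    using XX(1)[of Y] XX(2)[of X] pd_commute[of "xi V X" "Ind X" "Ind Y"] pd_commute[of "xi V Y" "Ind X" "Ind Y"]
    by simp_all
  have "(\<lambda>z. - pd (Ind Y) (pd (Ind Y) (xi V X)) z) = (\<lambda>_. 0)"
    using XX(2)[of X] pd_commute[of "xi V Y" "Ind X" "Ind Y"]
    by (simp add: xi_antisymmetric pd_minus smooth_pd)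
  then have 2: "pd (Ind Y) (pd (Ind Y) (xi V X)) = (\<lambda>_. 0)" by (simp add: fun_eq_iff)
  have 3: "pd (Ind X) (pd (Ind X) (xi V Y)) = (\<lambda>_. 0)"
    using 1(1) by (simp add: xi_antisymmetric pd_minus smooth_pd)
  show ?thesis
    using assms XX 1 2 3 by (cases i; cases j; cases k) (simp_all add: xi_T_gradient pd_const)
qed

lemma D_D_xi: "i \<noteq> T \<Longrightarrow> j \<noteq> T \<Longrightarrow> D i (on_jet (pd (Ind j) (xi V k))) = (\<lambda>_. 0)"
  using pd_commute[of "xi V k" h_coord "Ind j"]
  by (simp add: D_on_jet xi_second_derivs pd_h_xi pd_const on_jet_const)

lemma partial_h_Q: "partial h_coord Q = on_jet (pd h_coord (phi V))"
  unfolding characteristic_def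
  by (simp add: partial_simps pd_h_xi on_jet_const)

text \<open>
  From \<open>h\<^bsub>xxx\<^esub>\<close> and \<open>h\<^bsub>yyy\<^esub>\<close>, which occur in \<open>E\<close> only through the fourth-order terms.
\<close>

lemma pd_phi_h: "pd (Ind X) (pd h_coord (phi V)) = (\<lambda>_. 0)" "pd (Ind Y) (pd h_coord (phi V)) = (\<lambda>_. 0)"
   "pd h_coord (pd h_coord (phi V)) = (\<lambda>_. 0)"
proof -
  have "D i (on_jet (pd h_coord (phi V))) p = on_jet (\<lambda>_. 0) p" if "KS p = 0" "i = X \<or> i = Y" for p i
    using that partial_E_on_solutions[OF that(1), of "(3, 0, 0)"] partial_E_on_solutions[OF that(1), of "(0, 3, 0)"] nz
    by (auto simp: partial_E_third partial_ks on_jet_const D_xi D_D_xi partial_h_Q)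
  then show "pd (Ind X) (pd h_coord (phi V)) = (\<lambda>_. 0)" "pd (Ind Y) (pd h_coord (phi V)) = (\<lambda>_. 0)"
   "pd h_coord (pd h_coord (phi V)) = (\<lambda>_. 0)"
    using D_on_solutions[of "pd h_coord (phi V)" _ "\<lambda>_. 0"] by auto
qed

lemma D_phi_h: "i \<noteq> T \<Longrightarrow> D i (on_jet (pd h_coord (phi V))) = (\<lambda>_. 0)"
  by (cases i) (simp_all add: D_on_jet pd_phi_h on_jet_const)

lemma partial_E_second:
  "partial (Dep (2, 0, 0)) E p = - \<nu> * (on_jet (pd h_coord (phi V)) p - 2 * on_jet (pd (Ind X) (xi V X)) p)"
  by (simp add: partial_E_expand partial_h_Q D_xi D_D_xi D_phi_h algebra_simps
      del: prolong_coeff.simps D_multi.simps)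

text \<open>
  From \<open>h\<^bsub>xx\<^esub>\<close>: the second-order term requires \<open>\<tau>\<^sub>t = 2 \<xi>\<^sub>x\<close>, the fourth-order term has given
  \<open>\<tau>\<^sub>t = 4 \<xi>\<^sub>x\<close>.
\<close>

lemma pd_T_xi_T: "pd (Ind T) (xi V T) = (\<lambda>_. 0)"
proof
  fix z
  show "pd (Ind T) (xi V T) z = 0"
    using partial_E_on_solutions[of "jet_at z 0 0" "(2, 0, 0)"] nz
    by (simp add: partial_E_second partial_ks partial_E_t partial_h_Q xi_diagonal del: One_nat_def)
qed

lemma prolong_coeff_first:
  "prolong_coeff V (1, 0, 0) p = D X (on_jet (phi V)) p - (\<Sum>i\<in>{X, Y, T}. on_jet (pd (Ind X) (xi V i)) p * p (Dep (midx_unit i)))"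
  "prolong_coeff V (0, 1, 0) p = D Y (on_jet (phi V)) p - (\<Sum>i\<in>{X, Y, T}. on_jet (pd (Ind Y) (xi V i)) p * p (Dep (midx_unit i)))"
  unfolding prolong_coeff_eq[OF V_smooth] D_multi_expand characteristic_def transport_def
  by (simp_all add: D_diff D_add D_mult D_coord D_xi)

lemma partial_E_first:
  "partial (Dep (1, 0, 0)) E p = - on_jet (pd (Ind T) (xi V X)) p
     - 2 * lam * (D X (on_jet (phi V)) p + p (Dep (1, 0, 0)) * on_jet (pd h_coord (phi V)) p)"
  "partial (Dep (0, 1, 0)) E p = - on_jet (pd (Ind T) (xi V Y)) p
     - 2 * lam * (D Y (on_jet (phi V)) p + p (Dep (0, 1, 0)) * on_jet (pd h_coord (phi V)) p)"
  by (simp_all add: partial_E_expand partial_h_Q D_xi D_D_xi D_phi_h algebra_simps prolong_coeff_first[simplified One_nat_def]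
      del: prolong_coeff.simps D_multi.simps)
     (simp_all add: xi_T_gradient xi_diagonal pd_T_xi_T xi_antisymmetric on_jet_def)

text \<open>
  From \<open>h\<^sub>x\<close> and \<open>h\<^sub>y\<close>.  The relation is affine in the free value \<open>a\<close> of the first derivatives;
  the quadratic term of the equation is responsible for the coefficient \<open>\<phi>\<^sub>h\<close> of \<open>a\<close>.
\<close>

lemma phi_gradient:
  "pd (Ind X) (phi V) = (\<lambda>z. - (pd (Ind T) (xi V X) z / (2 * lam)))"
  "pd (Ind Y) (phi V) = (\<lambda>z. - (pd (Ind T) (xi V Y) z / (2 * lam)))"
  "pd h_coord (phi V) = (\<lambda>_. 0)"
proof -
  have "pd (Ind T) (xi V X) z + 2 * lam * (pd (Ind X) (phi V) z + a * pd h_coord (phi V) z) = 0"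
       "pd (Ind T) (xi V Y) z + 2 * lam * (pd (Ind Y) (phi V) z + a * pd h_coord (phi V) z) = 0" for z a
    using partial_E_on_solutions[of "jet_at z a a" "(1, 0, 0)"] partial_E_on_solutions[of "jet_at z a a" "(0, 1, 0)"]
    by (simp_all add: partial_E_first partial_ks partial_E_t partial_h_Q D_on_jet pd_T_xi_T jet_at_coord algebra_simps
        del: One_nat_def)
  note * = this
  show phi_u: "pd h_coord (phi V) = (\<lambda>_. 0)"
  proof
    fix z
    have "2 * lam * pd h_coord (phi V) z = 0"
      using *(1)[of z 0] *(1)[of z 1] unfolding distrib_left by linarith
    then show "pd h_coord (phi V) z = 0" using nz by simp
  qed
  show "pd (Ind X) (phi V) = (\<lambda>z. - (pd (Ind T) (xi V X) z / (2 * lam)))"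
       "pd (Ind Y) (phi V) = (\<lambda>z. - (pd (Ind T) (xi V Y) z / (2 * lam)))"
    using *[of _ 0] nz by (auto simp: phi_u field_simps eq_neg_iff_add_eq_0 fun_eq_iff)
qed

text \<open>
  Here the rotation speed \<open>\<xi>\<^sub>y = - \<eta>\<^sub>x\<close> is shown to be constant in time: \<open>\<phi>\<^bsub>xy\<^esub> = \<phi>\<^bsub>yx\<^esub>\<close> makes
  \<open>\<xi>\<^bsub>ty\<^esub>\<close> and \<open>\<eta>\<^bsub>tx\<^esub>\<close> equal, while antisymmetry makes them opposite.
\<close>

lemma pd_T_xi_flat:
  assumes "i = X \<or> i = Y"
  shows "pd (Ind X) (pd (Ind T) (xi V i)) = (\<lambda>_. 0)" "pd (Ind Y) (pd (Ind T) (xi V i)) = (\<lambda>_. 0)"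
proof -
  have same: "pd (Ind X) (pd (Ind T) (xi V X)) = (\<lambda>_. 0)" "pd (Ind Y) (pd (Ind T) (xi V Y)) = (\<lambda>_. 0)"
    using pd_commute[of "xi V X" "Ind X" "Ind T"] pd_commute[of "xi V Y" "Ind Y" "Ind T"]
    by (simp_all add: xi_diagonal pd_T_xi_T pd_const)
  have rot: "pd (Ind X) (pd (Ind T) (xi V Y)) = (\<lambda>z. - pd (Ind Y) (pd (Ind T) (xi V X)) z)"
    using pd_commute[of "xi V Y" "Ind X" "Ind T"] pd_commute[of "xi V X" "Ind Y" "Ind T"]
    by (simp add: xi_antisymmetric pd_minus smooth_pd)
  have sym: "pd (Ind X) (pd (Ind T) (xi V Y)) = pd (Ind Y) (pd (Ind T) (xi V X))"
    using pd_commute[of "phi V" "Ind X" "Ind Y"] nz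
    by (simp add: phi_gradient pd_minus_divide smooth_pd fun_eq_iff)
  have "pd (Ind Y) (pd (Ind T) (xi V X)) = (\<lambda>_. 0)"
    using rot sym by (simp add: fun_eq_iff)
  then show "pd (Ind X) (pd (Ind T) (xi V i)) = (\<lambda>_. 0)" "pd (Ind Y) (pd (Ind T) (xi V i)) = (\<lambda>_. 0)"
    using same sym assms by auto
qed

lemma D_D_phi: "i \<noteq> T \<Longrightarrow> D i (D i (on_jet (phi V))) = (\<lambda>_. 0)"
proof -
  assume "i \<noteq> T"
  have "pd h_coord (pd (Ind i) (phi V)) = (\<lambda>_. 0)"
    using pd_commute[of "phi V" h_coord "Ind i"] by (simp add: phi_gradient pd_const)
  moreover have "pd (Ind i) (pd (Ind i) (phi V)) = (\<lambda>_. 0)"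
    using \<open>i \<noteq> T\<close> by (cases i) (simp_all add: phi_gradient pd_minus_divide smooth_pd pd_T_xi_flat)
  ultimately show ?thesis
    by (simp add: D_on_jet phi_gradient on_jet_const)
qed

text \<open>
  At a jet whose derivatives all vanish, \<open>E\<close> reduces to
  \<open>\<phi>\<^sub>t - \<nu> \<nabla>\<^sup>2\<phi> + \<kappa> \<nabla>\<^sup>4\<phi>\<close>, where \<open>\<phi>\<^bsub>xx\<^esub>\<close> and \<open>\<phi>\<^bsub>yy\<^esub>\<close> vanish by
  \<open>D_D_phi\<close>.
\<close>

lemma pd_T_phi: "pd (Ind T) (phi V) = (\<lambda>_. 0)"
proof
  fix z
  let ?p = "jet_at z 0 0"
  have "E ?p = 0"
    using V KS_jet_at[of z 0 0] by (simp only: ks_symmetry_algebra_def mem_Collect_eq)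
  then show "pd (Ind T) (phi V) z = 0"
    unfolding prolongation_ks prolong_coeff_eq[OF V_smooth] D_multi_expand characteristic_def transport_def
    by (simp add: D_diff D_add D_mult D_coord D_xi D_D_xi D_D_phi D_const D_minus jet_at_coord
        D_on_jet[of "phi V" T])
qed

lemma pd_T_T_xi:
  assumes "i \<noteq> T"
  shows "pd (Ind T) (pd (Ind T) (xi V i)) = (\<lambda>_. 0)"
proof -
  have "pd (Ind T) (pd (Ind i) (phi V)) = (\<lambda>_. 0)"
    using pd_commute[of "phi V" "Ind T" "Ind i"] by (simp add: pd_T_phi pd_const)
  then show ?thesis
    using assms nz by (cases i) (simp_all add: phi_gradient pd_minus_divide smooth_pd fun_eq_iff)
qed

lemma pd_h_pd_xi: "pd h_coord (pd c (xi V i)) = (\<lambda>_. 0)"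
  using pd_commute[of "xi V i" h_coord c] by (simp add: pd_h_xi pd_const)

text \<open>
  All first derivatives are now known except \<open>\<xi>\<^sub>t\<close>, \<open>\<eta>\<^sub>t\<close> and \<open>\<xi>\<^sub>y\<close>, up to the relations found; these
  three have vanishing gradient and become the boost velocities \<open>c2\<close>, \<open>c5\<close> and the rotation
  speed \<open>c4\<close>.
\<close>

lemma symmetry_coefficients_affine:
  obtains c1 c2 c3 c4 c5 c6 c7 where
    "xi V X = affine_fun 0 c4 c2 0 c3" "xi V Y = affine_fun (- c4) 0 c5 0 c6" "xi V T = affine_fun 0 0 0 0 c1"
    "phi V = affine_fun (- (c2 / (2 * lam))) (- (c5 / (2 * lam))) 0 0 c7"
proof -
  have T_const: "\<exists>c. pd (Ind T) (xi V i) = (\<lambda>_. c)" if "i \<noteq> T" for i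
    using that by (intro const_of_gradient_zero smooth_pd V_coeffs)
      (cases i; simp add: pd_T_xi_flat pd_T_T_xi pd_h_pd_xi)+
  obtain c2 c5 where c2: "pd (Ind T) (xi V X) = (\<lambda>_. c2)" and c5: "pd (Ind T) (xi V Y) = (\<lambda>_. c5)"
    using T_const[of X] T_const[of Y] by auto
  have "\<exists>c. pd (Ind Y) (xi V X) = (\<lambda>_. c)"
    using pd_commute[of "xi V X" "Ind T" "Ind Y"]
    by (intro const_of_gradient_zero smooth_pd V_coeffs) (simp_all add: xi_second_derivs pd_h_pd_xi c2 pd_const)
  then obtain c4 where c4: "pd (Ind Y) (xi V X) = (\<lambda>_. c4)" by blast
  note grad = c2 c4 c5 xi_diagonal pd_T_xi_T xi_T_gradient xi_antisymmetric phi_gradient pd_T_phi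
  obtain c3 where "xi V X = affine_fun 0 c4 c2 0 c3"
    using affine_of_gradient_const[of "xi V X" 0 c4 c2 0] by (auto simp: grad)
  moreover obtain c6 where "xi V Y = affine_fun (- c4) 0 c5 0 c6"
    using affine_of_gradient_const[of "xi V Y" "- c4" 0 c5 0] by (auto simp: grad)
  moreover obtain c1 where "xi V T = affine_fun 0 0 0 0 c1"
    using affine_of_gradient_const[of "xi V T" 0 0 0 0] by (auto simp: grad)
  moreover obtain c7 where "phi V = affine_fun (- (c2 / (2 * lam))) (- (c5 / (2 * lam))) 0 0 c7"
    using affine_of_gradient_const[of "phi V" "- (c2 / (2 * lam))" "- (c5 / (2 * lam))" 0 0] by (auto simp: grad)
  ultimately show thesis by (rule that)
qed

end

section \<open>Conclusion\<close>

text \<open>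
  The total derivatives of affine coefficients \<open>\<xi>, \<eta>, \<tau>\<close> not involving \<open>h\<close> are constants, so
  \<open>E\<close> expands into few terms; the rotation cancels between them and the boosts cancel against the
  gradient of \<open>\<phi>\<close>.
\<close>

lemma affine_coefficients_symmetry:
  assumes "lam \<noteq> 0" and
    V: "xi V X = affine_fun 0 c4 c2 0 c3" "xi V Y = affine_fun (- c4) 0 c5 0 c6" "xi V T = affine_fun 0 0 0 0 c1"
    "phi V = affine_fun (- (c2 / (2 * lam))) (- (c5 / (2 * lam))) 0 0 c7"
  shows "V \<in> ks_symmetry_algebra \<nu> \<kappa> lam"
proof -
  have "smooth (xi V i)" for i by (cases i) (simp_all add: V smooth_affine)
  then have sV: "smooth_vector_field V" by (simp add: smooth_vector_field_def V smooth_affine)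
  have "prolongation 4 V (kuramoto_sivashinsky \<nu> \<kappa> lam) p = 0" for p
    unfolding prolongation_ks prolong_coeff_eq[OF sV] D_multi_expand characteristic_def transport_def
    using assms(1)
    by (simp add: V D_diff D_add D_mult D_minus D_coord D_const D_on_jet jet_fun_intros jet_fun_D smooth_affine pd_affine
        on_jet_const algebra_simps) (simp add: eval_nat_numeral)
  with sV show ?thesis by (simp add: ks_symmetry_algebra_def)
qed

theorem theorem1:
  fixes \<nu> \<kappa> lam :: real
  assumes "\<nu> \<noteq> 0" and "\<kappa> \<noteq> 0" and "lam \<noteq> 0"
  shows "ks_symmetry_algebra \<nu> \<kappa> lam =
    {V. \<exists>c1 c2 c3 c4 c5 c6 c7 :: real. \<forall>x y t h.
          xi V X (x, y, t, h) = c4 * y + c2 * t + c3 \<and>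
          xi V Y (x, y, t, h) = - c4 * x + c5 * t + c6 \<and>
          xi V T (x, y, t, h) = c1 \<and>
          phi V (x, y, t, h) = - (x / (2 * lam)) * c2 - (y / (2 * lam)) * c5 + c7}"
proof (intro equalityI subsetI CollectI)
  fix V assume V: "V \<in> ks_symmetry_algebra \<nu> \<kappa> lam"
  obtain c1 c2 c3 c4 c5 c6 c7 where
    coeffs: "xi V X = affine_fun 0 c4 c2 0 c3" "xi V Y = affine_fun (- c4) 0 c5 0 c6"
      "xi V T = affine_fun 0 0 0 0 c1" "phi V = affine_fun (- (c2 / (2 * lam))) (- (c5 / (2 * lam))) 0 0 c7"
    by (rule ks_symmetry.symmetry_coefficients_affine[OF ks_symmetry.intro[OF assms V]])
  show "\<exists>c1 c2 c3 c4 c5 c6 c7 :: real. \<forall>x y t h.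
          xi V X (x, y, t, h) = c4 * y + c2 * t + c3 \<and>
          xi V Y (x, y, t, h) = - c4 * x + c5 * t + c6 \<and>
          xi V T (x, y, t, h) = c1 \<and>
          phi V (x, y, t, h) = - (x / (2 * lam)) * c2 - (y / (2 * lam)) * c5 + c7"
    unfolding coeffs affine_fun_def
    by (rule exI[of _ c1], rule exI[of _ c2], rule exI[of _ c3], rule exI[of _ c4], rule exI[of _ c5],
        rule exI[of _ c6], rule exI[of _ c7]) (simp add: mult.commute)
next
  fix V :: vector_field
  assume "V \<in> {V. \<exists>c1 c2 c3 c4 c5 c6 c7 :: real. \<forall>x y t h.
          xi V X (x, y, t, h) = c4 * y + c2 * t + c3 \<and>
          xi V Y (x, y, t, h) = - c4 * x + c5 * t + c6 \<and>
          xi V T (x, y, t, h) = c1 \<and>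
          phi V (x, y, t, h) = - (x / (2 * lam)) * c2 - (y / (2 * lam)) * c5 + c7}"
  then obtain c1 c2 c3 c4 c5 c6 c7 where c: "\<forall>x y t h.
          xi V X (x, y, t, h) = c4 * y + c2 * t + c3 \<and>
          xi V Y (x, y, t, h) = - c4 * x + c5 * t + c6 \<and>
          xi V T (x, y, t, h) = c1 \<and>
          phi V (x, y, t, h) = - (x / (2 * lam)) * c2 - (y / (2 * lam)) * c5 + c7"
    by blast
  show "V \<in> ks_symmetry_algebra \<nu> \<kappa> lam"
    by (rule affine_coefficients_symmetry[OF assms(3), of V c4 c2 c3 c5 c6 c1 c7])
       (simp_all add: fun_eq_iff affine_fun_def c[rule_format] mult.commute[of c2] mult.commute[of c5])
qed

end
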